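(* Let $X,Y$ be Polish spaces and let $c:X\times Y\to[0,\infty)$ be a continuous cost function with $c(x,y)\le c_X(x)+c_Y(y)$ for all $(x,y)$, where $c_X:X\to\mathbb{R}$ and $c_Y:Y\to\mathbb{R}$ are fixed measurable functions. Let $a$ be a finite signed Borel measure on $X$ and $b$ a finite signed Borel measure on $Y$ with equal mass, $|a|(X)=|b|(Y)$, and equal integral, $a(X)=b(Y)$, and each with finite moment, $c_X\in L^1(|a|)$ and $c_Y\in L^1(|b|)$. Let $a=a^+-a^-$ and $b=b^+-b^-$ be the Jordan decompositions. Then $a$ and $b$ are connected by an optimal transport kernel (i.e. there is an optimal transport kernel $K$ with $aK=b$) if and only if there are $c$-CM compatible optimal couplings $\gamma^+$, between $a^+$ and $b^+$, and $\gamma^-$, between $a^-$ and $b^-$.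
   Context: For finite non-negative Borel measures $\mu$ on $X$ and $\nu$ on $Y$ of equal mass (not necessarily probabilities), a coupling is a non-negative measure on $X\times Y$ with marginals $\mu,\nu$; it is optimal if it minimizes $\int c\,d\gamma$ among all couplings of $\mu$ and $\nu$; $C(\mu,\nu)$ is the infimum. $|a|=a^++a^-$ is the total variation measure. A set $\Gamma\subset X\times Y$ is $c$-cyclically monotone ($c$-CM) if for every $N\in\mathbb{N}$, every permutation $\sigma$ of $\{1,\dots,N\}$ and all $(x_1,y_1),\dots,(x_N,y_N)\in\Gamma$, $\sum_{i=1}^N c(x_i,y_i)\le\sum_{i=1}^N c(x_i,y_{\sigma(i)})$. Two optimal couplings $\gamma_1,\gamma_2$ are $c$-CM compatible if $\operatorname{supp}(\gamma_1)\cup\operatorname{supp}(\gamma_2)$ is $c$-CM. Optimal transport kernels (for $c$) are of the following kinds. (i) A Markov kernel $K$ from $X$ to $Y$ (measurable in $x$, a probability measure on $Y$ for each $x$), acting on finite (signed) measures by $\mu K(B)=\int_X K(x,B)\,d\mu(x)$ and $\mu\odot K(A\times B)=\int_A K(x,B)\,d\mu(x)$, such that for every finite non-negative $\mu$ with $C(\mu,\mu K)<\infty$, $\mu\odot K$ is an optimal coupling between $\mu$ and $\mu K$. (ii) The kernel $K^\gamma$ associated to an optimal coupling $\gamma$ of finite non-negative measures $\mu$ on $X$ and $\nu$ on $Y$ with $c_X\in L^1(\mu)$, $c_Y\in L^1(\nu)$: it is defined only on finite (signed) measures $\eta\ll\mu$ with bounded density $\frac{d\eta}{d\mu}$ and $c_X\in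 L^1(|\eta|)$, by $d(\eta\odot K^\gamma)(x,y)=\frac{d\eta}{d\mu}(x)\,d\gamma(x,y)$ and $\eta K^\gamma=(\operatorname{proj}_Y)_\#(\eta\odot K^\gamma)$. Writing $aK$ presupposes that $a$ is in the domain of $K$. *)

theory Defs
  imports "HOL-Probability.Probability" "HOL-Combinatorics.Permutations"
begin

text \<open>
  A finite signed Borel measure is a real-valued, countably additive set function on the Borel sets.
  Its values on other sets carry no information, so two of them are equal when they agree on
  all Borel sets.
\<close>

definition finite_signed_measure :: "('a::topological_space set \<Rightarrow> real) \<Rightarrow> bool" where
  "finite_signed_measure a \<longleftrightarrow>
     (\<forall>A :: nat \<Rightarrow> 'a set. range A \<subseteq> sets borel \<longrightarrow> disjoint_family A \<longrightarrow>
        (\<lambda>i. a (A i)) sums a (\<Union>i. A i))"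

definition mutually_singular :: "'a::topological_space measure \<Rightarrow> 'a measure \<Rightarrow> bool" where
  "mutually_singular p n \<longleftrightarrow>
     (\<exists>P\<in>sets borel. emeasure p (- P) = 0 \<and> emeasure n P = 0)"

definition jordan_decomposition ::
    "('a::topological_space set \<Rightarrow> real) \<Rightarrow> 'a measure \<Rightarrow> 'a measure \<Rightarrow> bool" where
  "jordan_decomposition a p n \<longleftrightarrow>
     sets p = sets borel \<and> sets n = sets borel \<and> finite_measure p \<and> finite_measure n \<and>
     mutually_singular p n \<and> (\<forall>A\<in>sets borel. a A = measure p A - measure n A)"

text \<open>Existence and uniqueness are \<open>jordan_decomposition_ex1\<close> below.\<close>

definition positive_part :: "('a::topological_space set \<Rightarrow> real) \<Rightarrow> 'a measure" where
  "positive_part a = (THE p. \<exists>n. jordan_decomposition a p n)"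

definition negative_part :: "('a::topological_space set \<Rightarrow> real) \<Rightarrow> 'a measure" where
  "negative_part a = (THE n. \<exists>p. jordan_decomposition a p n)"

definition total_variation :: "('a::topological_space set \<Rightarrow> real) \<Rightarrow> 'a measure" where
  "total_variation a = measure_of UNIV (sets borel)
     (\<lambda>A. emeasure (positive_part a) A + emeasure (negative_part a) A)"

definition signed_integral :: "('a::topological_space set \<Rightarrow> real) \<Rightarrow> ('a \<Rightarrow> real) \<Rightarrow> real" where
  "signed_integral a f =
     (LINT x|positive_part a. f x) - (LINT x|negative_part a. f x)"

text \<open>
  The density of \<open>\<eta>\<close> with respect to \<open>\<mu>\<close>. It is meaningful only when
  \<open>absolutely_continuous \<mu> (total_variation \<eta>)\<close>, and determined up to \<open>\<mu>\<close>-null sets.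
\<close>

definition signed_density :: "'a::topological_space measure \<Rightarrow> ('a set \<Rightarrow> real) \<Rightarrow> 'a \<Rightarrow> real" where
  "signed_density \<mu> \<eta> x =
     enn2real (RN_deriv \<mu> (positive_part \<eta>) x) - enn2real (RN_deriv \<mu> (negative_part \<eta>) x)"

definition coupling ::
    "'a::topological_space measure \<Rightarrow> 'b::topological_space measure \<Rightarrow> ('a \<times> 'b) measure \<Rightarrow> bool" where
  "coupling \<mu> \<nu> \<gamma> \<longleftrightarrow>
     sets \<gamma> = sets borel \<and> distr \<gamma> borel fst = \<mu> \<and> distr \<gamma> borel snd = \<nu>"

definition plan_cost :: "('z \<Rightarrow> real) \<Rightarrow> 'z measure \<Rightarrow> ennreal" where
  "plan_cost c \<gamma> = (\<integral>\<^sup>+ z. ennreal (c z) \<partial>\<gamma>)"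

definition transport_cost ::
    "('a::topological_space \<times> 'b::topological_space \<Rightarrow> real) \<Rightarrow> 'a measure \<Rightarrow> 'b measure \<Rightarrow> ennreal" where
  "transport_cost c \<mu> \<nu> = (INF \<gamma>\<in>{\<gamma>. coupling \<mu> \<nu> \<gamma>}. plan_cost c \<gamma>)"

definition optimal_coupling ::
    "('a::topological_space \<times> 'b::topological_space \<Rightarrow> real) \<Rightarrow> 'a measure \<Rightarrow> 'b measure \<Rightarrow>
     ('a \<times> 'b) measure \<Rightarrow> bool" where
  "optimal_coupling c \<mu> \<nu> \<gamma> \<longleftrightarrow>
     coupling \<mu> \<nu> \<gamma> \<and> (\<forall>\<gamma>'. coupling \<mu> \<nu> \<gamma>' \<longrightarrow> plan_cost c \<gamma> \<le> plan_cost c \<gamma>')"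

definition supp :: "'z::topological_space measure \<Rightarrow> 'z set" where
  "supp \<gamma> = {z. \<forall>U. open U \<longrightarrow> z \<in> U \<longrightarrow> emeasure \<gamma> U > 0}"

definition cyclically_monotone :: "('a \<times> 'b \<Rightarrow> real) \<Rightarrow> ('a \<times> 'b) set \<Rightarrow> bool" where
  "cyclically_monotone c \<Gamma> \<longleftrightarrow>
     (\<forall>N::nat. \<forall>\<sigma>. \<sigma> permutes {1..N} \<longrightarrow>
        (\<forall>x y. (\<forall>i\<in>{1..N}. (x i, y i) \<in> \<Gamma>) \<longrightarrow>
           (\<Sum>i=1..N. c (x i, y i)) \<le> (\<Sum>i=1..N. c (x i, y (\<sigma> i)))))"

definition cm_compatible ::
    "('a::topological_space \<times> 'b::topological_space \<Rightarrow> real) \<Rightarrow>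
     ('a \<times> 'b) measure \<Rightarrow> ('a \<times> 'b) measure \<Rightarrow> bool" where
  "cm_compatible c \<gamma>\<^sub>1 \<gamma>\<^sub>2 \<longleftrightarrow> cyclically_monotone c (supp \<gamma>\<^sub>1 \<union> supp \<gamma>\<^sub>2)"

text \<open>
  \<open>\<mu> \<odot> K\<close> for a finite non-negative \<open>\<mu>\<close>; the plain image \<open>\<mu> K\<close> is the monadic bind
  \<open>\<mu> \<bind> K\<close> of the library. See \<open>emeasure_kernel_product\<close> for the value on rectangles.
\<close>

definition kernel_product ::
    "'a::topological_space measure \<Rightarrow> ('a \<Rightarrow> 'b::topological_space measure) \<Rightarrow> ('a \<times> 'b) measure" where
  "kernel_product \<mu> K = \<mu> \<bind> (\<lambda>x. distr (K x) borel (\<lambda>y. (x, y)))"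

text \<open>
  The two kinds of kernels: a Markov kernel, and the kernel \<open>K\<^sup>\<gamma>\<close> associated to a coupling
  \<open>\<gamma>\<close>, whose marginals are recovered from \<open>\<gamma>\<close>.
\<close>

datatype ('a, 'b) kernel =
    Markov "'a \<Rightarrow> 'b measure"
  | Associated "('a \<times> 'b) measure"

fun optimal_transport_kernel ::
    "('a::topological_space \<times> 'b::topological_space \<Rightarrow> real) \<Rightarrow> ('a \<Rightarrow> real) \<Rightarrow> ('b \<Rightarrow> real) \<Rightarrow>
     ('a, 'b) kernel \<Rightarrow> bool" where
  "optimal_transport_kernel c c\<^sub>X c\<^sub>Y (Markov K) \<longleftrightarrow>
     K \<in> borel \<rightarrow>\<^sub>M prob_algebra borel \<and>
     (\<forall>\<mu>. sets \<mu> = sets borel \<longrightarrow> finite_measure \<mu> \<longrightarrow> transport_cost c \<mu> (\<mu> \<bind> K) < \<infinity> \<longrightarrow>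
        optimal_coupling c \<mu> (\<mu> \<bind> K) (kernel_product \<mu> K))"
| "optimal_transport_kernel c c\<^sub>X c\<^sub>Y (Associated \<gamma>) \<longleftrightarrow>
     (\<exists>\<mu> \<nu>. finite_measure \<mu> \<and> finite_measure \<nu> \<and> integrable \<mu> c\<^sub>X \<and> integrable \<nu> c\<^sub>Y \<and>
        optimal_coupling c \<mu> \<nu> \<gamma>)"

fun in_kernel_domain ::
    "('a::topological_space \<Rightarrow> real) \<Rightarrow> ('a, 'b::topological_space) kernel \<Rightarrow> ('a set \<Rightarrow> real) \<Rightarrow> bool" where
  "in_kernel_domain c\<^sub>X (Markov K) \<eta> \<longleftrightarrow> finite_signed_measure \<eta>"
| "in_kernel_domain c\<^sub>X (Associated \<gamma>) \<eta> \<longleftrightarrow>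
     finite_signed_measure \<eta> \<and>
     absolutely_continuous (distr \<gamma> borel fst) (total_variation \<eta>) \<and>
     (\<exists>M. AE x in distr \<gamma> borel fst. \<bar>signed_density (distr \<gamma> borel fst) \<eta> x\<bar> \<le> M) \<and>
     integrable (total_variation \<eta>) c\<^sub>X"

text \<open>
  \<open>associated_product \<gamma> \<eta>\<close> is the signed measure \<open>\<eta> \<odot> K\<^sup>\<gamma>\<close>, with density
  \<open>(d\<eta>/d\<mu>)(x)\<close> with respect to \<open>\<gamma>\<close>; the image \<open>\<eta> K\<^sup>\<gamma>\<close> is its second marginal.
\<close>

definition associated_product ::
    "('a::topological_space \<times> 'b::topological_space) measure \<Rightarrow> ('a set \<Rightarrow> real) \<Rightarrow>
     ('a \<times> 'b) set \<Rightarrow> real" where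
  "associated_product \<gamma> \<eta> S =
     set_lebesgue_integral \<gamma> S (\<lambda>z. signed_density (distr \<gamma> borel fst) \<eta> (fst z))"

fun kernel_image ::
    "('a::topological_space set \<Rightarrow> real) \<Rightarrow> ('a, 'b::topological_space) kernel \<Rightarrow> 'b set \<Rightarrow> real" where
  "kernel_image \<eta> (Markov K) B = signed_integral \<eta> (\<lambda>x. measure (K x) B)"
| "kernel_image \<eta> (Associated \<gamma>) B = associated_product \<gamma> \<eta> (snd -` B)"

definition connected_by_kernel ::
    "('a::topological_space \<times> 'b::topological_space \<Rightarrow> real) \<Rightarrow> ('a \<Rightarrow> real) \<Rightarrow> ('b \<Rightarrow> real) \<Rightarrow>
     ('a set \<Rightarrow> real) \<Rightarrow> ('b set \<Rightarrow> real) \<Rightarrow> bool" where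
  "connected_by_kernel c c\<^sub>X c\<^sub>Y a b \<longleftrightarrow>
     (\<exists>K. optimal_transport_kernel c c\<^sub>X c\<^sub>Y K \<and> in_kernel_domain c\<^sub>X K a \<and>
        (\<forall>B\<in>sets borel. kernel_image a K B = b B))"

lemma fsm_empty: "finite_signed_measure a \<Longrightarrow> a {} = 0"
proof -
  assume "finite_signed_measure a"
  from this[unfolded finite_signed_measure_def, rule_format, of "\<lambda>_. {}"]
  have "(\<lambda>i::nat. a {}) sums a {}" by (simp add: disjoint_family_on_def)
  then have "(\<lambda>i::nat. a {}) \<longlonglongrightarrow> 0" by (intro summable_LIMSEQ_zero sums_summable)
  then show ?thesis by (simp add: LIMSEQ_const_iff)
qed

lemma sums_nonneg: "f sums (s::real) \<Longrightarrow> (\<And>i. 0 \<le> f i) \<Longrightarrow> 0 \<le> s"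
  by (rule sums_le[OF _ sums_zero])

lemma sums_nonpos: "f sums (s::real) \<Longrightarrow> (\<And>i. f i \<le> 0) \<Longrightarrow> s \<le> 0"
  by (rule sums_le[OF _ _ sums_zero])

lemma fsm_sums:
  "finite_signed_measure a \<Longrightarrow> (\<And>i::nat. A i \<in> sets borel) \<Longrightarrow> disjoint_family A \<Longrightarrow>
    (\<lambda>i. a (A i)) sums a (\<Union>i. A i)"
  unfolding finite_signed_measure_def by blast

lemma fsm_Un:
  assumes a: "finite_signed_measure a" and "A \<in> sets borel" "B \<in> sets borel" "A \<inter> B = {}"
  shows "a (A \<union> B) = a A + a B"
proof -
  have "(\<lambda>i. a (binaryset A B i)) sums a (\<Union>i. binaryset A B i)"
    using assms by (intro fsm_sums) (auto simp: binaryset_def disjoint_family_on_def)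
  moreover have "(\<lambda>i. a (binaryset A B i)) sums (a A + a B)"
    using fsm_empty[OF a] by (rule binaryset_sums)
  ultimately show ?thesis
    by (simp add: UN_binaryset_eq sums_unique2)
qed

lemma fsm_Diff:
  assumes a: "finite_signed_measure a" and "A \<in> sets borel" "B \<in> sets borel" "B \<subseteq> A"
  shows "a (A - B) = a A - a B"
proof -
  have "a (B \<union> (A - B)) = a B + a (A - B)" using assms by (intro fsm_Un) auto
  moreover have "B \<union> (A - B) = A" using assms by auto
  ultimately show ?thesis by simp
qed

definition pos_set :: "('a::topological_space set \<Rightarrow> real) \<Rightarrow> 'a set \<Rightarrow> bool" where
  "pos_set a P \<longleftrightarrow> P \<in> sets borel \<and> (\<forall>B\<in>sets borel. B \<subseteq> P \<longrightarrow> 0 \<le> a B)"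

lemma pos_set_UN:
  assumes a: "finite_signed_measure a" and P: "\<And>i::nat. pos_set a (P i)"
  shows "pos_set a (\<Union>i. P i)"
  unfolding pos_set_def
proof (intro conjI ballI impI)
  have [measurable]: "P i \<in> sets borel" for i using P by (simp add: pos_set_def)
  show "(\<Union>i. P i) \<in> sets borel" by auto
  fix B assume B[measurable]: "B \<in> sets borel" and sub: "B \<subseteq> (\<Union>i. P i)"
  have D[measurable]: "disjointed P i \<in> sets borel" for i
    using sets.range_disjointed_sets[of P borel] by (auto simp: subset_eq)
  have "(\<lambda>i. a (B \<inter> disjointed P i)) sums a (\<Union>i. B \<inter> disjointed P i)"
    using disjoint_family_disjointed[of P]
    by (intro fsm_sums[OF a]) (auto simp: disjoint_family_on_def)
  moreover have "(\<Union>i. B \<inter> disjointed P i) = B"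
    using sub UN_disjointed_eq[of P] by blast
  moreover have "0 \<le> a (B \<inter> disjointed P i)" for i
  proof -
    have "B \<inter> disjointed P i \<in> sets borel" using B D by (rule sets.Int)
    moreover have "B \<inter> disjointed P i \<subseteq> P i" using disjointed_subset[of P i] by blast
    ultimately show ?thesis using P[of i] by (simp add: pos_set_def)
  qed
  ultimately show "0 \<le> a B" using sums_nonneg by metis
qed

lemma pos_set_Un:
  assumes a: "finite_signed_measure a" and "pos_set a P" "pos_set a Q"
  shows "pos_set a (P \<union> Q)"
proof -
  have "pos_set a (\<Union>i::nat. if i = 0 then P else Q)"
    using assms by (intro pos_set_UN) auto
  moreover have "(\<Union>i::nat. if i = 0 then P else Q) = P \<union> Q" by (auto split: if_splits)
  ultimately show ?thesis by simp
qed

lemma pos_set_subset: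
  assumes a: "finite_signed_measure a" and A: "A \<in> sets borel"
  shows "\<exists>P\<subseteq>A. pos_set a P \<and> a A \<le> a P"
proof -
  have ex: "\<exists>B\<in>sets borel. B \<subseteq> E \<and> a B \<le> 0 \<and>
      (a B \<le> -1 \<or> (\<forall>C\<in>sets borel. C \<subseteq> E \<longrightarrow> 2 * a B \<le> a C))" for E
  proof (cases "\<exists>B\<in>sets borel. B \<subseteq> E \<and> a B \<le> -1")
    case True
    then show ?thesis by (meson le_minus_one_simps(1) order_trans)
  next
    case False
    let ?S = "a ` {C\<in>sets borel. C \<subseteq> E}"
    have bdd: "bdd_below ?S" using False by (intro bdd_belowI[of _ "-1"]) force
    have 0: "0 \<in> ?S" using fsm_empty[OF a] by force
    define m where "m = Inf ?S"
    have m: "m \<le> a C" if "C \<in> sets borel" "C \<subseteq> E" for C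
      unfolding m_def using bdd that by (intro cInf_lower) auto
    have "m \<le> 0" unfolding m_def using bdd 0 by (intro cInf_lower)
    show ?thesis
    proof (cases "m = 0")
      case True
      then show ?thesis using m fsm_empty[OF a] by (intro bexI[of _ "{}"]) auto
    next
      case neq: False
      then have "m < m / 2" using \<open>m \<le> 0\<close> by simp
      then obtain B where B: "B \<in> sets borel" "B \<subseteq> E" "a B < m / 2"
        using cInf_less_iff[of ?S "m / 2"] bdd 0 unfolding m_def[symmetric] by blast
      have "2 * a B \<le> a C" if "C \<in> sets borel" "C \<subseteq> E" for C
        using m[OF that] B by linarith
      then show ?thesis using B \<open>m \<le> 0\<close> by (intro bexI[of _ B]) auto
    qed
  qed
  then obtain g where g: "\<And>E. g E \<in> sets borel" "\<And>E. g E \<subseteq> E" "\<And>E. a (g E) \<le> 0"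
    "\<And>E. a (g E) \<le> -1 \<or> (\<forall>C\<in>sets borel. C \<subseteq> E \<longrightarrow> 2 * a (g E) \<le> a C)"
    by metis
  define F where "F = rec_nat A (\<lambda>_ E. E - g E)"
  have F: "F 0 = A" "F (Suc i) = F i - g (F i)" for i by (auto simp: F_def)
  have dec: "F j \<subseteq> F i" if "i \<le> j" for i j
    using that by (induction rule: dec_induct) (auto simp: F)
  have disj: "disjoint_family (\<lambda>i. g (F i))"
  proof -
    have *: "g (F i) \<inter> g (F j) = {}" if "i < j" for i j
      using dec[of "Suc i" j] g(2)[of "F j"] that by (auto simp: F)
    show ?thesis unfolding disjoint_family_on_def
      by (metis * Int_commute linorder_neqE_nat)
  qed
  define G where "G = (\<Union>i. g (F i))"
  have G: "G \<in> sets borel" "G \<subseteq> A"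
  proof -
    show "G \<in> sets borel" unfolding G_def using g(1) by (intro sets.countable_UN) auto
    have "g (F i) \<subseteq> A" for i using g(2)[of "F i"] dec[of 0 i] by (auto simp: F)
    then show "G \<subseteq> A" by (auto simp: G_def)
  qed
  have sums: "(\<lambda>i. a (g (F i))) sums a G"
    unfolding G_def by (intro fsm_sums[OF a] disj g)
  have "a G \<le> 0" by (rule sums_nonpos[OF sums g(3)])
  have lim: "(\<lambda>i. a (g (F i))) \<longlonglongrightarrow> 0"
    using sums by (intro summable_LIMSEQ_zero sums_summable)
  have "pos_set a (A - G)"
    unfolding pos_set_def
  proof (intro conjI ballI impI)
    show "A - G \<in> sets borel" using A G by auto
    fix C assume C: "C \<in> sets borel" "C \<subseteq> A - G"
    have sub: "C \<subseteq> F i" for i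
      by (induction i) (use C in \<open>auto simp: F G_def\<close>)
    have "eventually (\<lambda>i. a (g (F i)) > -1) sequentially"
      using order_tendstoD(1)[OF lim, of "-1"] by simp
    then have "eventually (\<lambda>i. 2 * a (g (F i)) \<le> a C) sequentially"
    proof eventually_elim
      case (elim i)
      then show ?case using g(4)[of "F i"] sub[of i] C by force
    qed
    moreover have "(\<lambda>i. 2 * a (g (F i))) \<longlonglongrightarrow> 2 * 0" by (intro tendsto_intros lim)
    ultimately show "0 \<le> a C"
      by (metis mult_zero_right tendsto_upperbound trivial_limit_sequentially)
  qed
  moreover have "a (A - G) = a A - a G" using A G by (intro fsm_Diff[OF a])
  ultimately show ?thesis using \<open>a G \<le> 0\<close> by (intro exI[of _ "A - G"]) auto
qed

lemma hahn_decomposition: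
  assumes a: "finite_signed_measure a"
  shows "\<exists>P. pos_set a P \<and> (\<forall>B\<in>sets borel. B \<inter> P = {} \<longrightarrow> a B \<le> 0)"
proof -
  let ?S = "a ` Collect (pos_set a)"
  have mono: "a Q \<le> a P" if "pos_set a P" "Q \<in> sets borel" "Q \<subseteq> P" for P Q
  proof -
    have "a (P - Q) = a P - a Q" using that by (intro fsm_Diff[OF a]) (auto simp: pos_set_def)
    moreover have "0 \<le> a (P - Q)" using that by (auto simp: pos_set_def)
    ultimately show ?thesis by simp
  qed
  have union: "\<exists>P. pos_set a P \<and> (\<forall>i. a (Q i) \<le> a P)" if "\<And>i::nat. pos_set a (Q i)" for Q
  proof (intro exI[of _ "\<Union>i. Q i"] conjI allI)
    show U: "pos_set a (\<Union>i. Q i)" using that by (rule pos_set_UN[OF a])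
    show "a (Q i) \<le> a (\<Union>i. Q i)" for i
      using that[of i] by (intro mono[OF U]) (auto simp: pos_set_def)
  qed
  have emp: "pos_set a {}" using fsm_empty[OF a] by (auto simp: pos_set_def)
  have bdd: "bdd_above ?S"
  proof (rule ccontr)
    assume "\<not> bdd_above ?S"
    then have "\<exists>Q. pos_set a Q \<and> a Q > real i" for i
      unfolding bdd_above_def by (auto simp: not_le)
    then obtain Q where Q: "\<And>i. pos_set a (Q i)" "\<And>i. a (Q i) > real i" by metis
    obtain P where "\<forall>i. a (Q i) \<le> a P" using union[of Q] Q by blast
    moreover obtain i where "a P < real i" using reals_Archimedean2 by blast
    ultimately show False using Q(2)[of i] by (meson less_le_not_le order_less_trans)
  qed
  define s where "s = Sup ?S"
  have s: "a Q \<le> s" if "pos_set a Q" for Q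
    unfolding s_def using that bdd by (intro cSup_upper) auto
  have "\<exists>Q. pos_set a Q \<and> s - 1 / real (Suc i) < a Q" for i
  proof -
    have "s - 1 / real (Suc i) < Sup ?S" by (simp add: s_def)
    moreover have "?S \<noteq> {}" using emp by auto
    ultimately show ?thesis using less_cSup_iff[OF _ bdd] by auto
  qed
  then obtain Q where Q: "\<And>i. pos_set a (Q i)" "\<And>i. s - 1 / real (Suc i) < a (Q i)" by metis
  obtain P where P: "pos_set a P" "\<And>i. a (Q i) \<le> a P" using union[of Q] Q by blast
  have "s \<le> a P"
  proof (rule field_le_epsilon)
    fix e :: real assume "e > 0"
    then obtain i where "inverse (real (Suc i)) < e" using reals_Archimedean by blast
    then show "s \<le> a P + e" using Q(2)[of i] P(2)[of i] by (simp add: inverse_eq_divide)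
  qed
  have "a B \<le> 0" if B: "B \<in> sets borel" "B \<inter> P = {}" for B
  proof -
    obtain R where R: "R \<subseteq> B" "pos_set a R" "a B \<le> a R" using pos_set_subset[OF a B(1)] by blast
    have "a (P \<union> R) = a P + a R"
      using R B P by (intro fsm_Un[OF a]) (auto simp: pos_set_def)
    moreover have "a (P \<union> R) \<le> s" using pos_set_Un[OF a P(1) R(2)] by (rule s)
    ultimately show ?thesis using \<open>s \<le> a P\<close> R by linarith
  qed
  then show ?thesis using P(1) by blast
qed

lemma signed_restrict_measure:
  fixes a :: "'a::topological_space set \<Rightarrow> real"
  assumes a: "finite_signed_measure a" and P: "P \<in> sets borel"
    and nn: "\<And>B. B \<in> sets borel \<Longrightarrow> B \<subseteq> P \<Longrightarrow> 0 \<le> e * a B"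
  obtains p :: "'a measure" where "sets p = sets borel" "finite_measure p"
    "\<And>A. A \<in> sets borel \<Longrightarrow> emeasure p A = ennreal (e * a (A \<inter> P))"
proof -
  define p where "p = measure_of UNIV (sets borel) (\<lambda>A. ennreal (e * a (A \<inter> P)))"
  have sets: "sets p = sets borel"
    unfolding p_def using sets.sets_measure_of_eq[of "borel :: 'a measure"] by simp
  have em: "emeasure p A = ennreal (e * a (A \<inter> P))" if "A \<in> sets borel" for A
  proof (rule emeasure_measure_of[OF p_def])
    show "positive (sets p) (\<lambda>A. ennreal (e * a (A \<inter> P)))"
      using fsm_empty[OF a] by (simp add: positive_def)
    show "countably_additive (sets p) (\<lambda>A. ennreal (e * a (A \<inter> P)))"
      unfolding countably_additive_def
    proof (intro allI impI)
      fix A :: "nat \<Rightarrow> 'a set"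
      assume A: "range A \<subseteq> sets p" "disjoint_family A"
      have "(\<lambda>i. a (A i \<inter> P)) sums a (\<Union>i. A i \<inter> P)"
        using A P sets by (intro fsm_sums[OF a]) (auto simp: disjoint_family_on_def)
      then have "(\<lambda>i. e * a (A i \<inter> P)) sums (e * a (\<Union>i. A i \<inter> P))" by (rule sums_mult)
      moreover have "0 \<le> e * a (A i \<inter> P)" for i
        using A sets P by (intro nn) auto
      ultimately have "(\<lambda>i. ennreal (e * a (A i \<inter> P))) sums ennreal (e * a (\<Union>i. A i \<inter> P))"
        using sums_nonneg by (subst sums_ennreal) blast+
      then show "(\<Sum>i. ennreal (e * a (A i \<inter> P))) = ennreal (e * a (\<Union>(range A) \<inter> P))"
        by (simp add: sums_iff)
    qed
  qed (use that sets in auto)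
  have "finite_measure p"
    by standard (use em[of UNIV] sets_eq_imp_space_eq[OF sets] in auto)
  then show thesis using that sets em by blast
qed

lemma jordan_le:
  assumes J: "jordan_decomposition a p n" and J': "jordan_decomposition a p' n'"
    and A: "A \<in> sets borel"
  shows "measure p A \<le> measure p' A"
proof -
  interpret p: finite_measure p using J by (simp add: jordan_decomposition_def)
  interpret n: finite_measure n using J by (simp add: jordan_decomposition_def)
  interpret p': finite_measure p' using J' by (simp add: jordan_decomposition_def)
  have [measurable_cong]: "sets p = sets borel" "sets n = sets borel" "sets p' = sets borel"
    using J J' by (auto simp: jordan_decomposition_def)
  obtain P where P[measurable]: "P \<in> sets borel" and P0: "emeasure p (- P) = 0" "emeasure n P = 0"
    using J by (auto simp: jordan_decomposition_def mutually_singular_def)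
  note A[measurable]
  have "measure p A = measure p (A \<inter> P) + measure p (A - P)"
    by (subst p.finite_measure_Union[symmetric]) (auto intro!: arg_cong[of _ _ "measure p"])
  moreover have "measure p (A - P) \<le> measure p (- P)"
    by (intro p.finite_measure_mono) auto
  moreover have "measure n (A \<inter> P) \<le> measure n P"
    by (intro n.finite_measure_mono) auto
  moreover have "measure p (- P) = 0" "measure n P = 0" using P0 by (auto simp: measure_def)
  ultimately have "measure p A = a (A \<inter> P)"
    using J A P measure_nonneg[of p "A - P"] measure_nonneg[of n "A \<inter> P"]
    by (auto simp: jordan_decomposition_def)
  also have "a (A \<inter> P) = measure p' (A \<inter> P) - measure n' (A \<inter> P)"
    using J' A P by (auto simp: jordan_decomposition_def)
  also have "\<dots> \<le> measure p' (A \<inter> P)" by simp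
  also have "\<dots> \<le> measure p' A" by (intro p'.finite_measure_mono) auto
  finally show ?thesis .
qed

lemma jordan_unique:
  assumes J: "jordan_decomposition a p n" and J': "jordan_decomposition a p' n'"
  shows "p = p'" "n = n'"
proof -
  have eq: "measure p A = measure p' A" if "A \<in> sets borel" for A
    using jordan_le[OF J J' that] jordan_le[OF J' J that] by simp
  have eq': "measure n A = measure n' A" if "A \<in> sets borel" for A
    using eq[OF that] J J' that by (auto simp: jordan_decomposition_def)
  show "p = p'" using J J' eq
    by (intro measure_eqI) (auto simp: jordan_decomposition_def finite_measure.emeasure_eq_measure)
  show "n = n'" using J J' eq'
    by (intro measure_eqI) (auto simp: jordan_decomposition_def finite_measure.emeasure_eq_measure)
qed

theorem jordan_decomposition_ex1:
  fixes a :: "'a::topological_space set \<Rightarrow> real"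
  assumes a: "finite_signed_measure a"
  shows "\<exists>!(p, n). jordan_decomposition a p n"
proof -
  obtain P where P: "pos_set a P" "\<And>B. B \<in> sets borel \<Longrightarrow> B \<inter> P = {} \<Longrightarrow> a B \<le> 0"
    using hahn_decomposition[OF a] by blast
  have PB: "P \<in> sets borel" "- P \<in> sets borel" using P by (auto simp: pos_set_def)
  obtain p :: "'a measure" where p: "sets p = sets borel" "finite_measure p"
      "\<And>A. A \<in> sets borel \<Longrightarrow> emeasure p A = ennreal (1 * a (A \<inter> P))"
    using signed_restrict_measure[OF a PB(1), of 1] P by (auto simp: pos_set_def)
  have "0 \<le> (- 1) * a B" if "B \<in> sets borel" "B \<subseteq> - P" for B
    using P(2)[of B] that by auto
  then obtain n :: "'a measure" where n: "sets n = sets borel" "finite_measure n"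
      "\<And>A. A \<in> sets borel \<Longrightarrow> emeasure n A = ennreal (- 1 * a (A \<inter> - P))"
    using signed_restrict_measure[OF a PB(2), of "- 1"] by metis
  have "a A = measure p A - measure n A" if A: "A \<in> sets borel" for A
  proof -
    have "0 \<le> a (A \<inter> P)" using P A by (auto simp: pos_set_def)
    moreover have "a (A \<inter> - P) \<le> 0" using A PB by (intro P(2)) auto
    moreover have "a ((A \<inter> P) \<union> (A \<inter> - P)) = a (A \<inter> P) + a (A \<inter> - P)"
      using A PB by (intro fsm_Un[OF a]) auto
    moreover have "(A \<inter> P) \<union> (A \<inter> - P) = A" by auto
    ultimately show ?thesis using p(3)[OF A] n(3)[OF A] by (simp add: measure_def)
  qed
  moreover have "emeasure p (- P) = 0" "emeasure n P = 0"
    using p(3)[OF PB(2)] n(3)[OF PB(1)] fsm_empty[OF a] by auto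
  then have "mutually_singular p n" using PB unfolding mutually_singular_def by blast
  ultimately have "jordan_decomposition a p n"
    using p(1,2) n(1,2) unfolding jordan_decomposition_def by blast
  then show ?thesis using jordan_unique[of a] by fast
qed

lemma jordan_decomposition_parts:
  assumes "finite_signed_measure a"
  shows "jordan_decomposition a (positive_part a) (negative_part a)"
proof -
  obtain p n where J: "jordan_decomposition a p n"
    using jordan_decomposition_ex1[OF assms] by auto
  have "positive_part a = p"
    unfolding positive_part_def using J jordan_unique(1) by (intro the_equality) blast+
  moreover have "negative_part a = n"
    unfolding negative_part_def using J jordan_unique(2) by (intro the_equality) blast+
  ultimately show ?thesis using J by simp
qed

lemma emeasure_total_variation:
  fixes a :: "'a::topological_space set \<Rightarrow> real"
  assumes a: "finite_signed_measure a" and A: "A \<in> sets borel"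
  shows "sets (total_variation a) = sets borel"
    and "emeasure (total_variation a) A = emeasure (positive_part a) A + emeasure (negative_part a) A"
proof -
  have J: "sets (positive_part a) = sets borel" "sets (negative_part a) = sets borel"
    using jordan_decomposition_parts[OF a] by (auto simp: jordan_decomposition_def)
  show sets: "sets (total_variation a) = sets borel"
    unfolding total_variation_def using sets.sets_measure_of_eq[of "borel :: 'a measure"] by simp
  show "emeasure (total_variation a) A = emeasure (positive_part a) A + emeasure (negative_part a) A"
  proof (rule emeasure_measure_of[OF total_variation_def])
    show "countably_additive (sets (total_variation a))
        (\<lambda>A. emeasure (positive_part a) A + emeasure (negative_part a) A)"
      unfolding countably_additive_def sets
      by (auto simp: J suminf_add[symmetric] suminf_emeasure)
  qed (use A sets in \<open>auto simp: positive_def\<close>)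
qed

lemma emeasure_kernel_product:
  fixes \<mu> :: "'a::second_countable_topology measure"
    and K :: "'a \<Rightarrow> 'b::second_countable_topology measure"
  assumes \<mu>: "sets \<mu> = sets borel" and K: "K \<in> borel \<rightarrow>\<^sub>M prob_algebra borel"
    and A: "A \<in> sets borel" and B: "B \<in> sets borel"
  shows "emeasure (kernel_product \<mu> K) (A \<times> B) = (\<integral>\<^sup>+x\<in>A. emeasure (K x) B \<partial>\<mu>)"
proof -
  have sp: "space \<mu> = UNIV" using sets_eq_imp_space_eq[OF \<mu>] by simp
  have K': "K \<in> borel \<rightarrow>\<^sub>M subprob_algebra borel" by (rule measurable_prob_algebraD[OF K])
  have sK: "sets (K x) = sets borel" for x
    using measurable_space[OF K', of x] by (simp add: space_subprob_algebra)
  have "(\<lambda>x. distr (K x) borel (Pair x)) \<in> borel \<rightarrow>\<^sub>M subprob_algebra borel"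
    by (rule measurable_distr2[OF _ K']) (simp add: borel_prod)
  then have "(\<lambda>x. distr (K x) borel (\<lambda>y. (x, y))) \<in> \<mu> \<rightarrow>\<^sub>M subprob_algebra borel"
    by (simp add: measurable_cong_sets[OF \<mu> refl])
  moreover have AB: "A \<times> B \<in> sets borel" using A B by (rule borel_Times)
  ultimately have "emeasure (kernel_product \<mu> K) (A \<times> B) =
      (\<integral>\<^sup>+x. emeasure (distr (K x) borel (\<lambda>y. (x, y))) (A \<times> B) \<partial>\<mu>)"
    unfolding kernel_product_def using sp by (intro emeasure_bind) auto
  also have "\<dots> = (\<integral>\<^sup>+x. emeasure (K x) B * indicator A x \<partial>\<mu>)"
  proof (rule nn_integral_cong)
    fix x
    have "(\<lambda>y. (x, y)) \<in> K x \<rightarrow>\<^sub>M borel"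
      by (subst measurable_cong_sets[OF sK refl]) (simp add: borel_prod[symmetric])
    then have "emeasure (distr (K x) borel (\<lambda>y. (x, y))) (A \<times> B) =
        emeasure (K x) ((\<lambda>y. (x, y)) -` (A \<times> B) \<inter> space (K x))"
      using AB by (rule emeasure_distr)
    also have "(\<lambda>y. (x, y)) -` (A \<times> B) \<inter> space (K x) = (if x \<in> A then B else {})"
      using sets_eq_imp_space_eq[OF sK[of x]] by auto
    finally show "emeasure (distr (K x) borel (\<lambda>y. (x, y))) (A \<times> B) =
        emeasure (K x) B * indicator A x" by simp
  qed
  finally show ?thesis .
qed

end

theory Submission
  imports Defs
begin

text \<open>
  If \<open>b = a K\<close>, then \<open>b = a\<^sup>+ K - a\<^sup>- K\<close>, and since the masses agree the minimality of the Jordan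
  decomposition forces \<open>a\<^sup>+ K = b\<^sup>+\<close> and \<open>a\<^sup>- K = b\<^sup>-\<close>. So the plan that \<open>K\<close> induces on \<open>|a|\<close> is
  optimal between \<open>|a|\<close> and \<open>|b|\<close> and contains those induced on \<open>a\<^sup>+\<close> and \<open>a\<^sup>-\<close>; for an associated
  kernel \<open>K\<^sup>\<gamma>\<close> the two plans have bounded densities with respect to \<open>\<gamma>\<close>, hence inherit optimality.
  In both cases the two supports lie in the support of one optimal plan of finite cost, which is
  cyclically monotone because the cost is continuous.

  Conversely, the sum of two compatible plans is a coupling of \<open>|a|\<close> and \<open>|b|\<close> with cyclically
  monotone support. Rueschendorf's potentials show that it is optimal, and its associated kernel
  maps \<open>a\<close>, whose density with respect to \<open>|a|\<close> is the sign of \<open>a\<close>, to \<open>b\<close>.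
\<close>

text \<open>Monotonicity of each support alone says nothing about cycles that mix points of both
  supports; hence the search for one optimal plan that carries both. Optimality passes to a plan
  with bounded density because a fixed multiple of that plan can be cut out of the given one with a
  nonnegative remainder: a cheaper competitor for the piece, glued to the remainder, would be a
  cheaper competitor for the whole. The same cut-and-replace principle yields cyclical monotonicity
  of supports. It relies on finite cost, since costs live in \<open>ennreal\<close> and the cost of
  the remainder must be cancelled; the moment conditions give finiteness for every coupling. In the
  converse, the potentials satisfy \<open>f x + g y \<le> c (x, y)\<close> only on a rectangle
  \<open>D \<times> E\<close>, with equality on the support. The rectangle suffices because its
  sides have full measure for the marginals, hence for every competitor, and integrability of the
  potentials lets the integral of \<open>f x + g y\<close> be computed from the marginals
  alone.\<close>

section \<open>Finite sums of Borel measures\<close>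

text \<open>The index set is \<open>{1..N}\<close> when mass is rerouted along a cycle, and
  \<open>UNIV :: bool set\<close> when two plans are added.\<close>

definition sum_measure :: "'i set \<Rightarrow> ('i \<Rightarrow> 'a::topological_space measure) \<Rightarrow> 'a measure" where
  "sum_measure I M = measure_of UNIV (sets borel) (\<lambda>A. \<Sum>i\<in>I. emeasure (M i) A)"

lemma sets_sum_measure [simp, measurable_cong]:
  fixes M :: "'i \<Rightarrow> 'a::topological_space measure"
  shows "sets (sum_measure I M) = sets borel"
  unfolding sum_measure_def using sets.sets_measure_of_eq[of "borel :: 'a measure"] by simp

lemma emeasure_sum_measure:
  fixes M :: "'i \<Rightarrow> 'a::topological_space measure"
  assumes M: "\<And>i. i \<in> I \<Longrightarrow> sets (M i) = sets borel" and A: "A \<in> sets borel"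
  shows "emeasure (sum_measure I M) A = (\<Sum>i\<in>I. emeasure (M i) A)"
proof (rule emeasure_measure_of[OF sum_measure_def])
  show "countably_additive (sets (sum_measure I M)) (\<lambda>A. \<Sum>i\<in>I. emeasure (M i) A)"
    unfolding countably_additive_def by (auto simp: M suminf_sum suminf_emeasure)
qed (use A in \<open>auto simp: positive_def\<close>)

text \<open>Stated for any \<open>L\<close> with additive values, so that it covers
  \<open>total_variation\<close> as well as \<open>sum_measure\<close>. In the induction over
  measurable functions, only the supremum step has content: monotonicity lets it pass through the
  sum.\<close>

lemma nn_integral_eq_sum:
  fixes f :: "'a \<Rightarrow> ennreal"
  assumes f: "f \<in> borel_measurable L"
    and M: "\<And>i. i \<in> I \<Longrightarrow> sets (M i) = sets L"
    and L: "\<And>A. A \<in> sets L \<Longrightarrow> emeasure L A = (\<Sum>i\<in>I. emeasure (M i) A)"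
  shows "(\<integral>\<^sup>+x. f x \<partial>L) = (\<Sum>i\<in>I. \<integral>\<^sup>+x. f x \<partial>M i)"
  using f
proof (induction rule: borel_measurable_induct)
  case (cong f g)
  have "(\<integral>\<^sup>+x. f x \<partial>L) = (\<integral>\<^sup>+x. g x \<partial>L)" using cong by (intro nn_integral_cong) auto
  moreover have "(\<integral>\<^sup>+x. f x \<partial>M i) = (\<integral>\<^sup>+x. g x \<partial>M i)" if "i \<in> I" for i
    using cong sets_eq_imp_space_eq[OF M[OF that]] by (intro nn_integral_cong) auto
  ultimately show ?case using cong by simp
next
  case (set A)
  then show ?case using L M by simp
next
  case (mult u c)
  have [measurable]: "u \<in> borel_measurable (M i)" if "i \<in> I" for i
    using mult M[OF that] by (simp cong: measurable_cong_sets)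
  show ?case using mult by (simp add: nn_integral_cmult sum_distrib_left)
next
  case (add u v)
  have [measurable]: "u \<in> borel_measurable (M i)" "v \<in> borel_measurable (M i)" if "i \<in> I" for i
    using add M[OF that] by (simp_all cong: measurable_cong_sets)
  show ?case using add by (simp add: nn_integral_add sum.distrib)
next
  case (seq U)
  have m: "U n \<in> borel_measurable (M i)" if "i \<in> I" for i n
    using seq M[OF that] by (simp cong: measurable_cong_sets)
  have "(\<integral>\<^sup>+x. (SUP i. U i) x \<partial>L) = (SUP n. \<integral>\<^sup>+x. U n x \<partial>L)"
    using seq by (simp add: nn_integral_monotone_convergence_SUP image_comp)
  also have "\<dots> = (SUP n. \<Sum>i\<in>I. \<integral>\<^sup>+x. U n x \<partial>M i)"
    using seq by simp
  also have "\<dots> = (\<Sum>i\<in>I. SUP n. \<integral>\<^sup>+x. U n x \<partial>M i)"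
  proof (rule ennreal_SUP_sum)
    fix i assume "i \<in> I"
    show "incseq (\<lambda>n. \<integral>\<^sup>+x. U n x \<partial>M i)"
      using \<open>incseq U\<close> by (auto simp: incseq_def le_fun_def intro!: nn_integral_mono)
  qed
  also have "\<dots> = (\<Sum>i\<in>I. \<integral>\<^sup>+x. (SUP n. U n) x \<partial>M i)"
    using seq m by (simp add: nn_integral_monotone_convergence_SUP image_comp)
  finally show ?case .
qed

lemma nn_integral_sum_measure:
  assumes "\<And>i. i \<in> I \<Longrightarrow> sets (M i) = sets borel" "f \<in> borel_measurable borel"
  shows "(\<integral>\<^sup>+x. f x \<partial>sum_measure I M) = (\<Sum>i\<in>I. \<integral>\<^sup>+x. f x \<partial>M i)"
  using assms by (intro nn_integral_eq_sum) (auto simp: emeasure_sum_measure cong: measurable_cong_sets)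

section \<open>Couplings, their marginals and their costs\<close>

lemma measurable_fst_borel [measurable]:
  "(fst :: 'a::second_countable_topology \<times> 'b::second_countable_topology \<Rightarrow> 'a) \<in> borel \<rightarrow>\<^sub>M borel"
  unfolding borel_prod[symmetric] by simp

lemma measurable_snd_borel [measurable]:
  "(snd :: 'a::second_countable_topology \<times> 'b::second_countable_topology \<Rightarrow> 'b) \<in> borel \<rightarrow>\<^sub>M borel"
  unfolding borel_prod[symmetric] by simp

lemma vimage_fst_borel: "A \<in> sets borel \<Longrightarrow>
  (fst -` A :: ('a::second_countable_topology \<times> 'b::second_countable_topology) set) \<in> sets borel"
  using measurable_sets[OF measurable_fst_borel, of A] by simp

lemma vimage_snd_borel: "A \<in> sets borel \<Longrightarrow>
  (snd -` A :: ('a::second_countable_topology \<times> 'b::second_countable_topology) set) \<in> sets borel"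
  using measurable_sets[OF measurable_snd_borel, of A] by simp

lemma emeasure_distr_borel:
  assumes "sets M = sets borel" "f \<in> borel \<rightarrow>\<^sub>M borel" "A \<in> sets borel"
  shows "emeasure (distr M borel f) A = emeasure M (f -` A)"
proof -
  have "f \<in> M \<rightarrow>\<^sub>M borel" using assms by (simp cong: measurable_cong_sets)
  then show ?thesis using assms sets_eq_imp_space_eq[OF assms(1)] by (simp add: emeasure_distr)
qed

lemma coupling_emeasure:
  fixes \<mu> :: "'a::second_countable_topology measure" and \<nu> :: "'b::second_countable_topology measure"
  assumes "coupling \<mu> \<nu> \<gamma>"
  shows coupling_fst: "A \<in> sets borel \<Longrightarrow> emeasure \<gamma> (fst -` A) = emeasure \<mu> A"
    and coupling_snd: "B \<in> sets borel \<Longrightarrow> emeasure \<gamma> (snd -` B) = emeasure \<nu> B"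
  using assms unfolding coupling_def by (auto simp: emeasure_distr_borel)

lemma coupling_sets:
  assumes "coupling \<mu> \<nu> \<gamma>"
  shows "sets \<gamma> = sets borel" "sets \<mu> = sets borel" "sets \<nu> = sets borel"
  using assms unfolding coupling_def by auto

lemma couplingI:
  fixes \<mu> :: "'a::second_countable_topology measure" and \<nu> :: "'b::second_countable_topology measure"
  assumes "sets \<gamma> = sets borel" "sets \<mu> = sets borel" "sets \<nu> = sets borel"
    and "\<And>A. A \<in> sets borel \<Longrightarrow> emeasure \<gamma> (fst -` A) = emeasure \<mu> A"
    and "\<And>B. B \<in> sets borel \<Longrightarrow> emeasure \<gamma> (snd -` B) = emeasure \<nu> B"
  shows "coupling \<mu> \<nu> \<gamma>"
  unfolding coupling_def using assms
  by (auto intro!: measure_eqI simp: emeasure_distr_borel)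

lemma coupling_distr:
  fixes \<gamma> :: "('a::second_countable_topology \<times> 'b::second_countable_topology) measure"
  assumes "sets \<gamma> = sets borel"
  shows "coupling (distr \<gamma> borel fst) (distr \<gamma> borel snd) \<gamma>"
  using assms by (simp add: coupling_def)

lemma coupling_finite:
  fixes \<mu> :: "'a::second_countable_topology measure" and \<nu> :: "'b::second_countable_topology measure"
  assumes g: "coupling \<mu> \<nu> \<gamma>" and \<mu>: "finite_measure \<mu>"
  shows "finite_measure \<gamma>"
proof
  have "emeasure \<gamma> UNIV = emeasure \<mu> UNIV" using coupling_fst[OF g, of UNIV] by simp
  then show "emeasure \<gamma> (space \<gamma>) \<noteq> \<infinity>"
    using coupling_sets[OF g] finite_measure.emeasure_finite[OF \<mu>]
    by (simp add: sets_eq_imp_space_eq[of \<gamma> borel])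
qed

lemma coupling_integrable_fst:
  fixes \<mu> :: "'a::second_countable_topology measure" and \<nu> :: "'b::second_countable_topology measure"
    and f :: "'a \<Rightarrow> real"
  assumes g: "coupling \<mu> \<nu> \<gamma>" and f: "f \<in> borel_measurable borel"
  shows "integrable \<mu> f \<longleftrightarrow> integrable \<gamma> (\<lambda>z. f (fst z))"
    and "(LINT x|\<mu>. f x) = (LINT z|\<gamma>. f (fst z))"
proof -
  have \<mu>: "\<mu> = distr \<gamma> borel fst" and [measurable_cong]: "sets \<gamma> = sets borel"
    using g by (auto simp: coupling_def)
  show "integrable \<mu> f \<longleftrightarrow> integrable \<gamma> (\<lambda>z. f (fst z))"
    unfolding \<mu> using f by (subst integrable_distr_eq) auto
  show "(LINT x|\<mu>. f x) = (LINT z|\<gamma>. f (fst z))"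
    unfolding \<mu> using f by (subst integral_distr) auto
qed

lemma coupling_integrable_snd:
  fixes \<mu> :: "'a::second_countable_topology measure" and \<nu> :: "'b::second_countable_topology measure"
    and f :: "'b \<Rightarrow> real"
  assumes g: "coupling \<mu> \<nu> \<gamma>" and f: "f \<in> borel_measurable borel"
  shows "integrable \<nu> f \<longleftrightarrow> integrable \<gamma> (\<lambda>z. f (snd z))"
    and "(LINT x|\<nu>. f x) = (LINT z|\<gamma>. f (snd z))"
proof -
  have \<nu>: "\<nu> = distr \<gamma> borel snd" and [measurable_cong]: "sets \<gamma> = sets borel"
    using g by (auto simp: coupling_def)
  show "integrable \<nu> f \<longleftrightarrow> integrable \<gamma> (\<lambda>z. f (snd z))"
    unfolding \<nu> using f by (subst integrable_distr_eq) auto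
  show "(LINT x|\<nu>. f x) = (LINT z|\<gamma>. f (snd z))"
    unfolding \<nu> using f by (subst integral_distr) auto
qed

text \<open>Nonnegativity of \<open>c\<close> turns the one-sided bound into a bound of the norm,
  although \<open>c\<^sub>X\<close> and \<open>c\<^sub>Y\<close> may be negative. The bound is
  integrable by the marginals alone, hence for every coupling.\<close>

lemma coupling_cost_integrable:
  fixes c :: "'a::second_countable_topology \<times> 'b::second_countable_topology \<Rightarrow> real"
  assumes c: "c \<in> borel_measurable borel" "\<And>z. 0 \<le> c z"
    and cX: "c\<^sub>X \<in> borel_measurable borel" and cY: "c\<^sub>Y \<in> borel_measurable borel"
    and le: "\<And>x y. c (x, y) \<le> c\<^sub>X x + c\<^sub>Y y"
    and g: "coupling \<mu> \<nu> \<gamma>" and i: "integrable \<mu> c\<^sub>X" "integrable \<nu> c\<^sub>Y"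
  shows "integrable \<gamma> c"
proof (rule Bochner_Integration.integrable_bound)
  note coupling_sets[OF g, measurable_cong]
  show "integrable \<gamma> (\<lambda>z. c\<^sub>X (fst z) + c\<^sub>Y (snd z))"
    using i coupling_integrable_fst(1)[OF g cX] coupling_integrable_snd(1)[OF g cY] by auto
  show "c \<in> borel_measurable \<gamma>" using c by simp
  show "AE z in \<gamma>. norm (c z) \<le> norm (c\<^sub>X (fst z) + c\<^sub>Y (snd z))"
  proof (rule AE_I2)
    fix z show "norm (c z) \<le> norm (c\<^sub>X (fst z) + c\<^sub>Y (snd z))"
      using le[of "fst z" "snd z"] c(2)[of z] by simp
  qed
qed

lemma plan_cost_finite:
  assumes "\<And>z. 0 \<le> c z" and "integrable \<gamma> c"
  shows "plan_cost c \<gamma> = ennreal (LINT z|\<gamma>. c z)" "plan_cost c \<gamma> < \<infinity>"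
  unfolding plan_cost_def using nn_integral_eq_integral[OF assms(2)] assms(1) by auto

lemma product_measure_marginals:
  fixes \<mu> :: "'a::second_countable_topology measure" and \<nu> :: "'b::second_countable_topology measure"
  assumes \<mu>: "sets \<mu> = sets borel" "finite_measure \<mu>" and \<nu>: "sets \<nu> = sets borel" "finite_measure \<nu>"
  shows "sets (\<mu> \<Otimes>\<^sub>M \<nu>) = sets borel"
    and "A \<in> sets borel \<Longrightarrow> emeasure (\<mu> \<Otimes>\<^sub>M \<nu>) (fst -` A) = emeasure \<mu> A * emeasure \<nu> UNIV"
    and "B \<in> sets borel \<Longrightarrow> emeasure (\<mu> \<Otimes>\<^sub>M \<nu>) (snd -` B) = emeasure \<mu> UNIV * emeasure \<nu> B"
proof -
  interpret \<nu>: finite_measure \<nu> by fact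
  show "sets (\<mu> \<Otimes>\<^sub>M \<nu>) = sets borel"
    using sets_pair_measure_cong[OF \<mu>(1) \<nu>(1)] by (metis borel_prod)
  have f: "fst -` A = A \<times> (UNIV :: 'b set)" for A :: "'a set" by auto
  have s: "snd -` B = (UNIV :: 'a set) \<times> B" for B :: "'b set" by auto
  show "emeasure (\<mu> \<Otimes>\<^sub>M \<nu>) (fst -` A) = emeasure \<mu> A * emeasure \<nu> UNIV" if "A \<in> sets borel"
    unfolding f using that \<mu> \<nu> by (intro \<nu>.emeasure_pair_measure_Times) auto
  show "emeasure (\<mu> \<Otimes>\<^sub>M \<nu>) (snd -` B) = emeasure \<mu> UNIV * emeasure \<nu> B" if "B \<in> sets borel"
    unfolding s using that \<mu> \<nu> by (intro \<nu>.emeasure_pair_measure_Times) auto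
qed

lemma coupling_exists:
  fixes \<mu> :: "'a::second_countable_topology measure" and \<nu> :: "'b::second_countable_topology measure"
  assumes \<mu>: "sets \<mu> = sets borel" "finite_measure \<mu>" and \<nu>: "sets \<nu> = sets borel" "finite_measure \<nu>"
    and eq: "emeasure \<mu> UNIV = emeasure \<nu> UNIV"
  shows "\<exists>\<gamma>. coupling \<mu> \<nu> \<gamma>"
proof -
  define m where "m = emeasure \<mu> UNIV"
  have fin: "m < \<infinity>" unfolding m_def using finite_measure.emeasure_finite[OF \<mu>(2)] by (simp add: less_top)
  \<comment> \<open>The plan below is the product measure divided by the common mass
    \<open>m\<close>. For \<open>m = 0\<close> the inverse is infinite, but then
    \<open>k = 0\<close>.\<close>
  have cancel: "k * m * inverse m = k" if "k \<le> m" for k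
  proof (cases "m = 0")
    case True
    then show ?thesis using that by simp
  next
    case False
    then show ?thesis using fin by (simp add: divide_ennreal_def[symmetric] ennreal_mult_divide_eq)
  qed
  have le: "emeasure \<mu> A \<le> m" "emeasure \<nu> B \<le> m" for A B
    unfolding m_def using emeasure_space[of \<mu> A] emeasure_space[of \<nu> B] \<mu> \<nu> eq
    by (simp_all add: sets_eq_imp_space_eq[of _ borel])
  have "coupling \<mu> \<nu> (scale_measure (inverse m) (\<mu> \<Otimes>\<^sub>M \<nu>))"
    using product_measure_marginals[OF \<mu> \<nu>] cancel[OF le(1)] cancel[OF le(2)] \<mu> \<nu> eq[symmetric]
    by (intro couplingI) (auto simp: m_def[symmetric] mult_ac)
  then show ?thesis ..
qed

text \<open>Discharges the finiteness premise under which a Markov kernel is required to induce an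
  optimal plan.\<close>

lemma transport_cost_finite:
  fixes c :: "'a::second_countable_topology \<times> 'b::second_countable_topology \<Rightarrow> real"
  assumes c: "c \<in> borel_measurable borel" "\<And>z. 0 \<le> c z"
    and cX: "c\<^sub>X \<in> borel_measurable borel" and cY: "c\<^sub>Y \<in> borel_measurable borel"
    and le: "\<And>x y. c (x, y) \<le> c\<^sub>X x + c\<^sub>Y y"
    and i: "integrable \<mu> c\<^sub>X" "integrable \<nu> c\<^sub>Y"
    and \<mu>: "sets \<mu> = sets borel" "finite_measure \<mu>" and \<nu>: "sets \<nu> = sets borel" "finite_measure \<nu>"
    and eq: "emeasure \<mu> UNIV = emeasure \<nu> UNIV"
  shows "transport_cost c \<mu> \<nu> < \<infinity>"
proof -
  obtain \<gamma> where g: "coupling \<mu> \<nu> \<gamma>" using coupling_exists[OF \<mu> \<nu> eq] by blast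
  have "transport_cost c \<mu> \<nu> \<le> plan_cost c \<gamma>"
    unfolding transport_cost_def using g by (intro INF_lower) auto
  also have "\<dots> < \<infinity>"
    using coupling_cost_integrable[OF c cX cY le g i] c(2) by (intro plan_cost_finite)
  finally show ?thesis .
qed

text \<open>With \<open>r = 1 / M\<close>, the plan splits as
  \<open>\<gamma> = rest + r * density \<gamma> f\<close>. If \<gamma>' competes with
  \<open>density \<gamma> f\<close>, then \<open>G = rest + r * \<gamma>'\<close> competes with
  \<gamma>, and comparing the two costs gives the claim. Used for the exchange along a cycle and for
  associated kernels.\<close>

lemma optimal_coupling_density:
  fixes c :: "'a::second_countable_topology \<times> 'b::second_countable_topology \<Rightarrow> real"
    and f :: "'a \<times> 'b \<Rightarrow> ennreal"
  assumes opt: "optimal_coupling c \<mu> \<nu> \<gamma>" and fin: "plan_cost c \<gamma> < \<infinity>"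
    and c[measurable]: "c \<in> borel_measurable borel"
    and f[measurable]: "f \<in> borel_measurable borel"
    and M: "0 < M" "AE z in \<gamma>. f z \<le> ennreal M"
  shows "optimal_coupling c (distr (density \<gamma> f) borel fst) (distr (density \<gamma> f) borel snd) (density \<gamma> f)"
  unfolding optimal_coupling_def
proof (intro conjI allI impI)
  have g: "coupling \<mu> \<nu> \<gamma>" using opt by (simp add: optimal_coupling_def)
  note coupling_sets(1)[OF g, measurable_cong]
  have [simp]: "sets \<gamma> = sets borel" by (rule coupling_sets(1)[OF g])
  show g1: "coupling (distr (density \<gamma> f) borel fst) (distr (density \<gamma> f) borel snd) (density \<gamma> f)"
    by (intro coupling_distr) simp
  fix \<gamma>' assume g': "coupling (distr (density \<gamma> f) borel fst) (distr (density \<gamma> f) borel snd) \<gamma>'"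
  have [simp]: "sets \<gamma>' = sets borel" by (rule coupling_sets(1)[OF g'])
  note this[measurable_cong]
  define r where "r = ennreal (1 / M)"
  have r: "0 < r" "r < \<infinity>" using M by (auto simp: r_def)
  define rest where "rest = density \<gamma> (\<lambda>z. 1 - r * f z)"
  define G where "G = sum_measure UNIV (\<lambda>b. if b then rest else scale_measure r \<gamma>')"
  \<comment> \<open>Subtraction in \<open>ennreal\<close> is truncated at 0, so the splitting holds
    only because \<open>r * f z \<le> 1\<close> almost everywhere.\<close>
  have split: "(\<integral>\<^sup>+z. h z \<partial>\<gamma>) = (\<integral>\<^sup>+z. h z \<partial>rest) + r * (\<integral>\<^sup>+z. h z \<partial>density \<gamma> f)"
    if [measurable]: "h \<in> borel_measurable borel" for h
  proof -
    have le: "AE z in \<gamma>. r * f z \<le> 1"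
      using M(2)
    proof eventually_elim
      case (elim z)
      have "r * f z \<le> r * ennreal M" using elim by (intro mult_left_mono) auto
      also have "\<dots> = 1" using M(1) by (simp add: r_def ennreal_mult[symmetric])
      finally show ?case .
    qed
    have "(\<integral>\<^sup>+z. h z \<partial>rest) + r * (\<integral>\<^sup>+z. h z \<partial>density \<gamma> f) =
        (\<integral>\<^sup>+z. (1 - r * f z) * h z + r * (f z * h z) \<partial>\<gamma>)"
      unfolding rest_def by (simp add: nn_integral_density nn_integral_add nn_integral_cmult)
    also have "\<dots> = (\<integral>\<^sup>+z. h z \<partial>\<gamma>)"
      using le
    proof (intro nn_integral_cong_AE, eventually_elim)
      case (elim z)
      have "(1 - r * f z) * h z + r * (f z * h z) = ((1 - r * f z) + r * f z) * h z"
        by (simp add: distrib_right mult.assoc)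
      also have "(1 - r * f z) + r * f z = 1" using elim by (auto intro: diff_add_cancel_ennreal)
      finally show ?case by simp
    qed
    finally show ?thesis by simp
  qed
  \<comment> \<open>The competitor need not agree with \<open>density \<gamma> f\<close> on all
    sets, only on preimages under the two projections; hence the premise on
    \<open>S\<close>.\<close>
  have emG: "emeasure G S = emeasure \<gamma> S"
    if "emeasure \<gamma>' S = emeasure (density \<gamma> f) S" "S \<in> sets borel" for S
    using split[of "indicator S"] that by (simp add: G_def emeasure_sum_measure UNIV_bool rest_def)
  have "coupling \<mu> \<nu> G"
  proof (rule couplingI)
    show "emeasure G (fst -` A) = emeasure \<mu> A" if "A \<in> sets borel" for A
      using coupling_fst[OF g that] coupling_fst[OF g' that] coupling_fst[OF g1 that]
        vimage_fst_borel[OF that] by (subst emG) auto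
    show "emeasure G (snd -` B) = emeasure \<nu> B" if "B \<in> sets borel" for B
      using coupling_snd[OF g that] coupling_snd[OF g' that] coupling_snd[OF g1 that]
        vimage_snd_borel[OF that] by (subst emG) auto
  qed (use coupling_sets[OF g] in \<open>auto simp: G_def\<close>)
  then have "plan_cost c \<gamma> \<le> plan_cost c G" using opt by (auto simp: optimal_coupling_def)
  also have "plan_cost c G = plan_cost c rest + r * plan_cost c \<gamma>'"
    unfolding plan_cost_def G_def
    by (subst nn_integral_sum_measure) (auto simp: UNIV_bool rest_def nn_integral_scale_measure)
  also have "plan_cost c \<gamma> = plan_cost c rest + r * plan_cost c (density \<gamma> f)"
    using split[of "\<lambda>z. ennreal (c z)"] by (simp add: plan_cost_def)
  finally have "plan_cost c rest + r * plan_cost c (density \<gamma> f) \<le> plan_cost c rest + r * plan_cost c \<gamma>'" .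
  \<comment> \<open>Finiteness of this common summand is what permits its cancellation in
    \<open>ennreal\<close>.\<close>
  moreover have "plan_cost c rest < \<infinity>"
    using fin split[of "\<lambda>z. ennreal (c z)"] by (auto simp: plan_cost_def)
  ultimately have "r * plan_cost c (density \<gamma> f) \<le> r * plan_cost c \<gamma>'"
    by (auto simp: ennreal_add_left_cancel_le)
  then show "plan_cost c (density \<gamma> f) \<le> plan_cost c \<gamma>'"
    using r by (auto simp: ennreal_mult_le_mult_iff)
qed

section \<open>Supports, and cyclical monotonicity of optimal plans\<close>

lemma supp_mono:
  assumes "\<And>U. open U \<Longrightarrow> emeasure M U > 0 \<Longrightarrow> emeasure N U > 0"
  shows "supp M \<subseteq> supp N"
  using assms by (auto simp: supp_def)

text \<open>The complement of the support is covered by the null members of a countable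
  basis.\<close>

lemma AE_in_supp:
  fixes M :: "'a::second_countable_topology measure"
  assumes M: "sets M = sets borel"
  shows "AE z in M. z \<in> supp M"
proof -
  obtain \<B> :: "'a set set" where \<B>: "countable \<B>" "topological_basis \<B>"
    using ex_countable_basis by blast
  let ?N = "{B\<in>\<B>. emeasure M B = 0}"
  have "AE z in M. \<forall>B\<in>?N. z \<notin> B"
    using \<B> M topological_basis_open[OF \<B>(2)]
    by (subst AE_ball_countable) (auto intro!: AE_not_in simp: null_sets_def)
  moreover have "z \<in> supp M" if z: "\<forall>B\<in>?N. z \<notin> B" for z
    unfolding supp_def
  proof (clarify)
    fix U assume U: "open U" "z \<in> U"
    then obtain B where B: "B \<in> \<B>" "z \<in> B" "B \<subseteq> U" using topological_basisE[OF \<B>(2)] by metis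
    then have "0 < emeasure M B" using z by (auto simp: zero_less_iff_neq_zero)
    moreover have "emeasure M B \<le> emeasure M U" using B U M by (intro emeasure_mono) auto
    ultimately show "emeasure M U > 0" by (rule order.strict_trans2)
  qed
  ultimately show ?thesis by (auto elim: eventually_mono)
qed

text \<open>If a cycle through the points \<open>(x i, y i)\<close> of the support violated monotonicity, then
  rerouting a little mass near these points along the cycle would lower the cost.\<close>

lemma optimal_coupling_supp_cyclically_monotone:
  fixes c :: "'a::polish_space \<times> 'b::polish_space \<Rightarrow> real"
  assumes c: "continuous_on UNIV c" and nn: "\<And>z. 0 \<le> c z"
    and opt: "optimal_coupling c \<mu> \<nu> \<gamma>" and \<mu>: "finite_measure \<mu>"
    and fin: "plan_cost c \<gamma> < \<infinity>"
  shows "cyclically_monotone c (supp \<gamma>)"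
  unfolding cyclically_monotone_def
proof (intro allI impI)
  fix N :: nat and \<sigma> and x :: "nat \<Rightarrow> 'a" and y :: "nat \<Rightarrow> 'b"
  assume \<sigma>: "\<sigma> permutes {1..N}" and xy: "\<forall>i\<in>{1..N}. (x i, y i) \<in> supp \<gamma>"
  have cm[measurable]: "c \<in> borel_measurable borel" using c by (rule borel_measurable_continuous_onI)
  have g: "coupling \<mu> \<nu> \<gamma>" using opt by (simp add: optimal_coupling_def)
  have [simp]: "sets \<gamma> = sets borel" by (rule coupling_sets(1)[OF g])
  note this[measurable_cong]
  interpret \<gamma>: finite_measure \<gamma> by (rule coupling_finite[OF g \<mu>])
  let ?I = "{1..N}"
  have \<sigma>I: "\<sigma> i \<in> ?I" if "i \<in> ?I" for i using permutes_in_image[OF \<sigma>] that by simp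
  \<comment> \<open>Costs at the points are compared with average costs near them; the error is at
    most \<open>e\<close> for each of the \<open>N\<close> points on either side, hence the factor
    2.\<close>
  have main: "(\<Sum>i\<in>?I. c (x i, y i)) \<le> (\<Sum>i\<in>?I. c (x i, y (\<sigma> i))) + 2 * (real N * e)" if e: "e > 0" for e
  proof -
    have "\<exists>d>0. \<forall>z. dist z w < d \<longrightarrow> \<bar>c z - c w\<bar> < e" for w
      using c e unfolding continuous_on_iff dist_real_def by blast
    then obtain D where D: "\<And>w. D w > 0" "\<And>w z. dist z w < D w \<Longrightarrow> \<bar>c z - c w\<bar> < e" by metis
    \<comment> \<open>The element 1 keeps the set nonempty when \<open>N = 0\<close>. Balls of
      radius \<open>d/2\<close> suffice because distances in the product are at most the sum of
      those in the coordinates.\<close>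
    define d where "d = Min (insert 1 ((\<lambda>(i, j). D (x i, y j)) ` (?I \<times> ?I)))"
    have d0: "d > 0" unfolding d_def by (subst Min_gr_iff) (auto simp: D)
    have near: "\<bar>c z - c (x i, y j)\<bar> < e"
      if "i \<in> ?I" "j \<in> ?I" "z \<in> ball (x i) (d/2) \<times> ball (y j) (d/2)" for i j z
    proof (rule D(2))
      have "d \<le> D (x i, y j)" unfolding d_def using that by (intro Min_le) auto
      moreover have "dist z (x i, y j) \<le> dist (fst z) (x i) + dist (snd z) (y j)"
        unfolding dist_prod_def using sqrt_sum_squares_le_sum[of "dist (fst z) (x i)" "dist (snd z) (y j)"] by simp
      ultimately show "dist z (x i, y j) < D (x i, y j)"
        using that by (auto simp: dist_commute)
    qed
    define A where "A i = ball (x i) (d/2) \<times> ball (y i) (d/2)" for i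
    have Ao: "open (A i)" for i by (simp add: A_def open_Times)
    then have A[measurable]: "A i \<in> sets borel" for i by simp
    have A0: "emeasure \<gamma> (A i) > 0" if "i \<in> ?I" for i
      using xy that Ao d0 by (auto simp: supp_def A_def)
    define P where "P i = uniform_measure \<gamma> (A i)" for i
    have sP[simp]: "sets (P i) = sets borel" for i by (simp add: P_def)
    have P: "prob_space (P i)" if "i \<in> ?I" for i
      unfolding P_def using A0[OF that] by (intro prob_space_uniform_measure) auto
    have P1: "emeasure (P i) UNIV = 1" if "i \<in> ?I" for i
      using prob_space.emeasure_space_1[OF P[OF that]] by (simp add: sets_eq_imp_space_eq[OF sP])
    define X where "X i = distr (P i) borel fst" for i
    define Y where "Y i = distr (P i) borel snd" for i
    have cP: "coupling (X i) (Y i) (P i)" for i unfolding X_def Y_def by (intro coupling_distr) simp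
    have fX: "finite_measure (X i)" and fY: "finite_measure (Y i)" if "i \<in> ?I" for i
    proof -
      have "fst \<in> P i \<rightarrow>\<^sub>M borel" "snd \<in> P i \<rightarrow>\<^sub>M borel" by (simp_all cong: measurable_cong_sets)
      then have "prob_space (X i)" "prob_space (Y i)" unfolding X_def Y_def
        using P[OF that] by (auto intro: prob_space.prob_space_distr)
      then show "finite_measure (X i)" "finite_measure (Y i)" by (auto simp: prob_space_def)
    qed
    have [simp]: "sets (X i) = sets borel" "sets (Y i) = sets borel" for i by (auto simp: X_def Y_def)
    have X1: "emeasure (X i) UNIV = 1" and Y1: "emeasure (Y i) UNIV = 1" if "i \<in> ?I" for i
      using coupling_fst[OF cP, of UNIV i] coupling_snd[OF cP, of UNIV i] P1[OF that] by auto
    \<comment> \<open>Chosen so that \<open>density \<gamma> f\<close> is the sum of the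
      probabilities \<open>P i\<close>. Overlapping boxes and repeated points do no harm, since only
      an upper bound of \<open>f\<close> is required.\<close>
    define f where "f z = (\<Sum>i\<in>?I. inverse (emeasure \<gamma> (A i)) * indicator (A i) z)" for z
    have f[measurable]: "f \<in> borel_measurable borel" unfolding f_def by measurable
    have inv: "inverse (emeasure \<gamma> (A i)) < \<infinity>" if "i \<in> ?I" for i
      using A0[OF that] by (simp add: ennreal_inverse_eq_top_iff less_top[symmetric])
    obtain M where M: "M > 0" "(\<Sum>i\<in>?I. inverse (emeasure \<gamma> (A i))) \<le> ennreal M"
    proof -
      have "(\<Sum>i\<in>?I. inverse (emeasure \<gamma> (A i))) < top" using inv by (simp add: less_top)
      then have "(\<Sum>i\<in>?I. inverse (emeasure \<gamma> (A i))) = ennreal (enn2real (\<Sum>i\<in>?I. inverse (emeasure \<gamma> (A i))))"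
        by (rule ennreal_enn2real[symmetric])
      \<comment> \<open>Adding 1 makes the bound positive also for the empty sum.\<close>
      also have "\<dots> \<le> ennreal (enn2real (\<Sum>i\<in>?I. inverse (emeasure \<gamma> (A i))) + 1)"
        by (intro ennreal_leI) simp
      finally show thesis by (rule that[rotated]) (simp add: add_nonneg_pos)
    qed
    have f_le: "f z \<le> ennreal M" for z
      unfolding f_def by (rule order.trans[OF sum_mono M(2)]) (auto simp: indicator_def)
    have dens: "(\<integral>\<^sup>+z. h z \<partial>density \<gamma> f) = (\<Sum>i\<in>?I. \<integral>\<^sup>+z. h z \<partial>P i)"
      if [measurable]: "h \<in> borel_measurable borel" for h
    proof -
      have "(\<integral>\<^sup>+z. h z \<partial>density \<gamma> f) = (\<integral>\<^sup>+z. (\<Sum>i\<in>?I. inverse (emeasure \<gamma> (A i)) * (h z * indicator (A i) z)) \<partial>\<gamma>)"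
        by (subst nn_integral_density) (simp_all only: f_def sum_distrib_left sum_distrib_right mult_ac, measurable)
      also have "\<dots> = (\<Sum>i\<in>?I. \<integral>\<^sup>+z. h z \<partial>P i)"
        by (simp add: nn_integral_sum nn_integral_cmult P_def nn_integral_uniform_measure divide_ennreal_def)
          (simp add: mult.commute)
      finally show ?thesis .
    qed
    have densE: "emeasure (density \<gamma> f) S = (\<Sum>i\<in>?I. emeasure (P i) S)" if "S \<in> sets borel" for S
      using dens[OF borel_measurable_indicator[OF that]] that by simp
    \<comment> \<open>The rerouted plan: first coordinates near \<open>x i\<close> are paired
      independently with second coordinates near \<open>y (\<sigma> i)\<close>. Summing over
      \<open>i\<close> restores the second marginal, as \<sigma> only permutes the summands.\<close>
    define Q where "Q = sum_measure ?I (\<lambda>i. X i \<Otimes>\<^sub>M Y (\<sigma> i))"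
    have pr: "sets (X i \<Otimes>\<^sub>M Y (\<sigma> i)) = sets borel"
      "A \<in> sets borel \<Longrightarrow> emeasure (X i \<Otimes>\<^sub>M Y (\<sigma> i)) (fst -` A) = emeasure (X i) A"
      "B \<in> sets borel \<Longrightarrow> emeasure (X i \<Otimes>\<^sub>M Y (\<sigma> i)) (snd -` B) = emeasure (Y (\<sigma> i)) B"
      if i: "i \<in> ?I" for i A B
      using product_measure_marginals[of "X i" "Y (\<sigma> i)", OF _ fX[OF i] _ fY[OF \<sigma>I[OF i]]] X1[OF i] Y1[OF \<sigma>I[OF i]]
      by simp_all
    have "coupling (distr (density \<gamma> f) borel fst) (distr (density \<gamma> f) borel snd) Q"
    proof (rule couplingI)
      fix B :: "'a set" assume B: "B \<in> sets borel"
      have "emeasure Q (fst -` B) = (\<Sum>i\<in>?I. emeasure (X i) B)"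
        unfolding Q_def using vimage_fst_borel[OF B] pr B by (subst emeasure_sum_measure) auto
      also have "\<dots> = (\<Sum>i\<in>?I. emeasure (P i) (fst -` B))"
        using coupling_fst[OF cP B] by simp
      also have "\<dots> = emeasure (density \<gamma> f) (fst -` B)"
        using densE[OF vimage_fst_borel[OF B]] by simp
      finally show "emeasure Q (fst -` B) = emeasure (distr (density \<gamma> f) borel fst) B"
        using B by (simp only: emeasure_distr_borel sets_density \<open>sets \<gamma> = sets borel\<close> measurable_fst_borel measurable_snd_borel)
    next
      fix B :: "'b set" assume B: "B \<in> sets borel"
      have "emeasure Q (snd -` B) = (\<Sum>i\<in>?I. emeasure (Y (\<sigma> i)) B)"
        unfolding Q_def using vimage_snd_borel[OF B] pr B by (subst emeasure_sum_measure) auto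
      also have "\<dots> = (\<Sum>i\<in>?I. emeasure (Y i) B)"
        using sum.permute[OF \<sigma>, of "\<lambda>i. emeasure (Y i) B"] by (simp add: comp_def)
      also have "\<dots> = (\<Sum>i\<in>?I. emeasure (P i) (snd -` B))"
        using coupling_snd[OF cP B] by simp
      also have "\<dots> = emeasure (density \<gamma> f) (snd -` B)"
        using densE[OF vimage_snd_borel[OF B]] by simp
      finally show "emeasure Q (snd -` B) = emeasure (distr (density \<gamma> f) borel snd) B"
        using B by (simp only: emeasure_distr_borel sets_density \<open>sets \<gamma> = sets borel\<close> measurable_fst_borel measurable_snd_borel)
    qed (auto simp: Q_def)
    then have le: "plan_cost c (density \<gamma> f) \<le> plan_cost c Q"
      using optimal_coupling_density[OF opt fin cm f M(1)] f_le by (auto simp: optimal_coupling_def)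
    have inA: "AE z in P i. z \<in> A i" if "i \<in> ?I" for i
      unfolding P_def using A0[OF that] by (intro AE_uniform_measureI) auto
    have lower: "ennreal (c (x i, y i)) \<le> (\<integral>\<^sup>+z. ennreal (c z) \<partial>P i) + ennreal e" if i: "i \<in> ?I" for i
    proof -
      have "ennreal (c (x i, y i)) = (\<integral>\<^sup>+z. ennreal (c (x i, y i)) \<partial>P i)"
        using P[OF i] by (simp add: prob_space.emeasure_space_1)
      also have "\<dots> \<le> (\<integral>\<^sup>+z. ennreal (c z) + ennreal e \<partial>P i)"
        using inA[OF i]
      proof (intro nn_integral_mono_AE, eventually_elim)
        case (elim z)
        then have "c (x i, y i) \<le> c z + e" using near[OF i i, of z] by (auto simp: A_def abs_less_iff)
        then show ?case using nn e by (simp add: ennreal_plus[symmetric] ennreal_leI del: ennreal_plus)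
      qed
      also have "\<dots> = (\<integral>\<^sup>+z. ennreal (c z) \<partial>P i) + ennreal e"
        using P[OF i] by (subst nn_integral_add) (auto simp: prob_space.emeasure_space_1 cong: measurable_cong_sets)
      finally show ?thesis .
    qed
    \<comment> \<open>Each factor is concentrated on its ball, so the product is concentrated on the
      box where \<open>near\<close> applies to the pair \<open>i\<close>,
      \<open>\<sigma> i\<close>.\<close>
    have upper: "(\<integral>\<^sup>+z. ennreal (c z) \<partial>(X i \<Otimes>\<^sub>M Y (\<sigma> i))) \<le> ennreal (c (x i, y (\<sigma> i)) + e)" if i: "i \<in> ?I" for i
    proof -
      let ?R = "X i \<Otimes>\<^sub>M Y (\<sigma> i)" and ?U = "ball (x i) (d/2)" and ?V = "ball (y (\<sigma> i)) (d/2)"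
      note pr(1)[OF i, measurable_cong]
      have "emeasure ?R UNIV = 1" using pr(2)[OF i, of UNIV] X1[OF i] by simp
      then have R1: "emeasure ?R (space ?R) = 1" by (simp add: sets_eq_imp_space_eq[OF pr(1)[OF i]])
      have "AE z in P i. z \<in> fst -` ?U"
        using inA[OF i] by eventually_elim (auto simp: A_def)
      moreover have "AE z in P (\<sigma> i). z \<in> snd -` ?V"
        using inA[OF \<sigma>I[OF i]] by eventually_elim (auto simp: A_def)
      ultimately have "emeasure (P i) (- fst -` ?U) = 0" "emeasure (P (\<sigma> i)) (- snd -` ?V) = 0"
        using vimage_fst_borel[of ?U, where 'b='b] vimage_snd_borel[of ?V, where 'a='a]
        by (auto simp: AE_iff_null sets_eq_imp_space_eq[OF sP] null_sets_def Compl_eq)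
      then have "emeasure (X i) (- ?U) = 0" "emeasure (Y (\<sigma> i)) (- ?V) = 0"
        using coupling_fst[OF cP, of "- ?U" i] coupling_snd[OF cP, of "- ?V" "\<sigma> i"]
        by (auto simp: vimage_Compl)
      then have "emeasure ?R (fst -` (- ?U)) = 0" "emeasure ?R (snd -` (- ?V)) = 0"
        using pr(2,3)[OF i] by auto
      then have "AE z in ?R. z \<notin> fst -` (- ?U)" "AE z in ?R. z \<notin> snd -` (- ?V)"
        by (intro AE_not_in null_setsI; simp only: pr(1)[OF i]; intro vimage_fst_borel vimage_snd_borel; simp)+
      then have "AE z in ?R. ennreal (c z) \<le> ennreal (c (x i, y (\<sigma> i)) + e)"
      proof eventually_elim
        case (elim z)
        then have "z \<in> ?U \<times> ?V" by (cases z) auto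
        from near[OF i \<sigma>I[OF i] this] show ?case by (intro ennreal_leI) (auto simp: abs_less_iff)
      qed
      then have "(\<integral>\<^sup>+z. ennreal (c z) \<partial>?R) \<le> (\<integral>\<^sup>+z. ennreal (c (x i, y (\<sigma> i)) + e) \<partial>?R)"
        by (rule nn_integral_mono_AE)
      then show ?thesis using R1 by simp
    qed
    have "ennreal (\<Sum>i\<in>?I. c (x i, y i)) = (\<Sum>i\<in>?I. ennreal (c (x i, y i)))"
      using nn by (simp add: sum_ennreal)
    also have "\<dots> \<le> (\<Sum>i\<in>?I. (\<integral>\<^sup>+z. ennreal (c z) \<partial>P i) + ennreal e)"
      by (intro sum_mono lower)
    also have "\<dots> = plan_cost c (density \<gamma> f) + ennreal (real N * e)"
      using e by (simp add: plan_cost_def dens sum.distrib ennreal_of_nat_eq_real_of_nat ennreal_mult[symmetric])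
    also have "\<dots> \<le> plan_cost c Q + ennreal (real N * e)"
      using le by (rule add_right_mono)
    also have "plan_cost c Q = (\<Sum>i\<in>?I. \<integral>\<^sup>+z. ennreal (c z) \<partial>(X i \<Otimes>\<^sub>M Y (\<sigma> i)))"
      unfolding plan_cost_def Q_def using pr(1) by (subst nn_integral_sum_measure) auto
    also have "(\<Sum>i\<in>?I. \<integral>\<^sup>+z. ennreal (c z) \<partial>(X i \<Otimes>\<^sub>M Y (\<sigma> i))) + ennreal (real N * e) \<le>
        (\<Sum>i\<in>?I. ennreal (c (x i, y (\<sigma> i)) + e)) + ennreal (real N * e)"
      by (intro add_right_mono sum_mono upper)
    also have "\<dots> = ennreal ((\<Sum>i\<in>?I. c (x i, y (\<sigma> i)) + e) + real N * e)"
      using nn e by (simp add: sum_ennreal ennreal_plus[symmetric] sum_nonneg add_nonneg_nonneg del: ennreal_plus)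
    finally have "(\<Sum>i\<in>?I. c (x i, y i)) \<le> (\<Sum>i\<in>?I. c (x i, y (\<sigma> i)) + e) + real N * e"
      using nn e by (subst (asm) ennreal_le_iff) (auto intro!: add_nonneg_nonneg sum_nonneg)
    then show ?thesis by (simp add: sum.distrib mult.commute)
  qed
  show "(\<Sum>i=1..N. c (x i, y i)) \<le> (\<Sum>i=1..N. c (x i, y (\<sigma> i)))"
  proof (rule field_le_epsilon)
    fix e :: real assume e: "e > 0"
    \<comment> \<open>The denominator \<open>2 * real N + 1\<close> absorbs the error and stays
      positive for \<open>N = 0\<close>.\<close>
    have "2 * (real N * (e / (2 * real N + 1))) \<le> e"
      using e by (simp add: field_simps)
    then show "(\<Sum>i\<in>?I. c (x i, y i)) \<le> (\<Sum>i\<in>?I. c (x i, y (\<sigma> i))) + e"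
      using main[of "e / (2 * real N + 1)"] e by (simp add: add_pos_nonneg)
  qed
qed

section \<open>Potentials of a cyclically monotone set, and optimality\<close>

text \<open>Here \<open>s\<close> is the alternating sum \<open>- c (x\<^sub>0, y\<^sub>0) + c
  (x\<^sub>1, y\<^sub>0) - c (x\<^sub>1, y\<^sub>1) + ...\<close> up to the last point, whose second
  coordinate is \<open>y\<close>. The final hop \<open>c (x, y)\<close> is left open, so that one
  chain serves all end points \<open>x\<close>, and prolonging a chain by a point of \<Gamma> is a
  single rule.\<close>

inductive chain :: "('a \<times> 'b \<Rightarrow> real) \<Rightarrow> ('a \<times> 'b) set \<Rightarrow> 'a \<Rightarrow> 'b \<Rightarrow> 'b \<Rightarrow> real \<Rightarrow> bool"
  for c \<Gamma> x\<^sub>0 y\<^sub>0 where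
  start: "chain c \<Gamma> x\<^sub>0 y\<^sub>0 y\<^sub>0 (- c (x\<^sub>0, y\<^sub>0))"
| step: "chain c \<Gamma> x\<^sub>0 y\<^sub>0 y s \<Longrightarrow> (x', y') \<in> \<Gamma> \<Longrightarrow>
    chain c \<Gamma> x\<^sub>0 y\<^sub>0 y' (s + c (x', y) - c (x', y'))"

text \<open>Cyclical monotonicity speaks of families indexed by \<open>{1..N}\<close>, so the chain
  is unrolled into one; \<open>n\<close> steps visit \<open>Suc n\<close> points.\<close>

lemma chain_sequence:
  assumes "chain c \<Gamma> x\<^sub>0 y\<^sub>0 y s" "(x\<^sub>0, y\<^sub>0) \<in> \<Gamma>"
  shows "\<exists>n xs ys. xs 1 = x\<^sub>0 \<and> ys (Suc n) = y \<and> (\<forall>i\<in>{1..Suc n}. (xs i, ys i) \<in> \<Gamma>) \<and>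
    s = (\<Sum>i=1..n. c (xs (Suc i), ys i)) - (\<Sum>i=1..Suc n. c (xs i, ys i))"
  using assms
proof (induction rule: chain.induct)
  case start
  then show ?case by (intro exI[of _ 0] exI[of _ "\<lambda>_. x\<^sub>0"] exI[of _ "\<lambda>_. y\<^sub>0"]) simp
next
  case (step y s x' y')
  then obtain n xs ys where *: "xs 1 = x\<^sub>0" "ys (Suc n) = y" "\<forall>i\<in>{1..Suc n}. (xs i, ys i) \<in> \<Gamma>"
    "s = (\<Sum>i=1..n. c (xs (Suc i), ys i)) - (\<Sum>i=1..Suc n. c (xs i, ys i))" by blast
  let ?xs = "xs(Suc (Suc n) := x')" and ?ys = "ys(Suc (Suc n) := y')"
  have "(\<Sum>i=1..n. c (?xs (Suc i), ?ys i)) = (\<Sum>i=1..n. c (xs (Suc i), ys i))"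
    by (intro sum.cong) auto
  moreover have "(\<Sum>i=1..Suc n. c (?xs i, ?ys i)) = (\<Sum>i=1..Suc n. c (xs i, ys i))"
    by (intro sum.cong) auto
  ultimately have "s + c (x', y) - c (x', y') =
      (\<Sum>i=1..Suc n. c (?xs (Suc i), ?ys i)) - (\<Sum>i=1..Suc (Suc n). c (?xs i, ?ys i))"
    using *(2,4) by simp
  moreover have "\<forall>i\<in>{1..Suc (Suc n)}. (?xs i, ?ys i) \<in> \<Gamma>"
    using *(3) step.hyps(2) by (auto simp: le_Suc_eq)
  ultimately show ?case using *(1)
    by (intro exI[of _ "Suc n"] exI[of _ ?xs] exI[of _ ?ys]) simp
qed

text \<open>The hop back to \<open>x\<^sub>0\<close> closes the chain to a cycle, whose total
  increment is nonnegative by cyclical monotonicity. This keeps the potential at the base point away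
  from minus infinity.\<close>

lemma chain_nonneg:
  assumes cm: "cyclically_monotone c \<Gamma>" and \<Gamma>: "(x\<^sub>0, y\<^sub>0) \<in> \<Gamma>" and ch: "chain c \<Gamma> x\<^sub>0 y\<^sub>0 y s"
  shows "0 \<le> c (x\<^sub>0, y) + s"
proof -
  obtain n xs ys where *: "xs 1 = x\<^sub>0" "ys (Suc n) = y" "\<forall>i\<in>{1..Suc n}. (xs i, ys i) \<in> \<Gamma>"
    "s = (\<Sum>i=1..n. c (xs (Suc i), ys i)) - (\<Sum>i=1..Suc n. c (xs i, ys i))"
    using chain_sequence[OF ch \<Gamma>] by blast
  \<comment> \<open>The backward shift: each \<open>xs i\<close> meets the preceding
    \<open>ys (i - 1)\<close>, and \<open>xs 1\<close> meets the last one. For \<open>n = 0\<close>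
    it is the identity.\<close>
  define \<sigma> where "\<sigma> i = (if i = 1 then Suc n else if i \<in> {2..Suc n} then i - 1 else i)" for i
  have "bij_betw \<sigma> {1..Suc n} {1..Suc n}"
    by (rule bij_betw_byWitness[where f' = "\<lambda>i. if i = Suc n then 1 else Suc i"]) (auto simp: \<sigma>_def)
  then have "\<sigma> permutes {1..Suc n}"
    by (rule bij_imp_permutes) (auto simp: \<sigma>_def)
  then have "(\<Sum>i=1..Suc n. c (xs i, ys i)) \<le> (\<Sum>i=1..Suc n. c (xs i, ys (\<sigma> i)))"
    using cm *(3) unfolding cyclically_monotone_def by blast
  also have "\<dots> = c (x\<^sub>0, y) + (\<Sum>i=Suc 1..Suc n. c (xs i, ys (\<sigma> i)))"
    using * by (subst sum.atLeast_Suc_atMost) (auto simp: \<sigma>_def)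
  also have "(\<Sum>i=Suc 1..Suc n. c (xs i, ys (\<sigma> i))) = (\<Sum>i=1..n. c (xs (Suc i), ys i))"
    unfolding sum.shift_bounds_cl_Suc_ivl by (intro sum.cong) (auto simp: \<sigma>_def)
  finally show ?thesis using *(4) by simp
qed

text \<open>The infimum is upper semicontinuous: its strict sublevel sets are unions of open sets,
  whatever the size of the index set. This matters because the chains and the set \<open>D\<close>
  may be uncountable.\<close>

lemma borel_measurable_INF_continuous:
  fixes f :: "'i \<Rightarrow> 'a::topological_space \<Rightarrow> real"
  assumes f: "\<And>i. i \<in> I \<Longrightarrow> continuous_on UNIV (f i)"
  shows "(\<lambda>x. INF i\<in>I. ereal (f i x)) \<in> borel_measurable borel"
proof (rule borel_measurableI_less)
  fix t :: ereal
  have "open {x. ereal (f i x) < t}" if "i \<in> I" for i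
    using f[OF that] by (intro open_Collect_less continuous_intros)
  then have "open (\<Union>i\<in>I. {x. ereal (f i x) < t})" by blast
  moreover have "{x \<in> space borel. (INF i\<in>I. ereal (f i x)) < t} = (\<Union>i\<in>I. {x. ereal (f i x) < t})"
    by (auto simp: INF_less_iff)
  ultimately show "{x \<in> space borel. (INF i\<in>I. ereal (f i x)) < t} \<in> sets borel" by simp
qed

text \<open>Rueschendorf's potentials: \<open>\<phi> x\<close> is the least increment of the cost along chains of points of
  \<open>\<Gamma>\<close> from a base point to \<open>x\<close>, and \<open>\<psi>\<close> is its \<open>c\<close>-transform. Both are infima of continuous
  functions, which makes them measurable; they are real on the projections of \<open>\<Gamma>\<close>.\<close>

lemma cyclically_monotone_potentials:
  fixes c :: "'a::polish_space \<times> 'b::polish_space \<Rightarrow> real"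
  assumes c: "continuous_on UNIV c" and nn: "\<And>z. 0 \<le> c z"
    and cm: "cyclically_monotone c \<Gamma>" and \<Gamma>: "(x\<^sub>0, y\<^sub>0) \<in> \<Gamma>"
  obtains f g D E where "f \<in> borel_measurable borel" "g \<in> borel_measurable borel"
    "D \<in> sets borel" "E \<in> sets borel" "\<Gamma> \<subseteq> D \<times> E"
    "\<And>x y. (x, y) \<in> \<Gamma> \<Longrightarrow> f x + g y = c (x, y)"
    "\<And>x y. x \<in> D \<Longrightarrow> y \<in> E \<Longrightarrow> f x + g y \<le> c (x, y)"
    "\<And>x. x \<in> D \<Longrightarrow> f x \<le> c (x, y\<^sub>0)" "\<And>y. y \<in> E \<Longrightarrow> g y \<le> c (x\<^sub>0, y)"
proof -
  define \<phi> where "\<phi> x = (INF p\<in>{(y, s). chain c \<Gamma> x\<^sub>0 y\<^sub>0 y s}. ereal (c (x, fst p) + snd p))" for x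
  \<comment> \<open>The trivial chain bounds \<phi> from above, so minus infinity is the only value
    that prevents it from being real.\<close>
  define D where "D = {x. \<phi> x \<noteq> -\<infinity>}"
  define f where "f x = real_of_ereal (\<phi> x)" for x
  define \<psi> where "\<psi> y = (INF x\<in>D. ereal (c (x, y) - f x))" for y
  define E where "E = {y. \<psi> y \<noteq> -\<infinity>}"
  define g where "g y = real_of_ereal (\<psi> y)" for y
  have cx: "continuous_on UNIV (\<lambda>x. c (x, y))" for y
    by (rule continuous_on_compose2[OF c]) (auto intro!: continuous_intros)
  have cy: "continuous_on UNIV (\<lambda>y. c (x, y))" for x
    by (rule continuous_on_compose2[OF c]) (auto intro!: continuous_intros)
  have \<phi>m[measurable]: "\<phi> \<in> borel_measurable borel"
    unfolding \<phi>_def using cx by (intro borel_measurable_INF_continuous continuous_intros)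
  have \<psi>m[measurable]: "\<psi> \<in> borel_measurable borel"
    unfolding \<psi>_def using cy by (intro borel_measurable_INF_continuous continuous_intros)
  have \<phi>_le: "\<phi> x \<le> ereal (c (x, y) + s)" if "chain c \<Gamma> x\<^sub>0 y\<^sub>0 y s" for x y s
    unfolding \<phi>_def using that by (intro INF_lower2[of "(y, s)"]) auto
  have \<phi>_le0: "\<phi> x \<le> ereal (c (x, y\<^sub>0) - c (x\<^sub>0, y\<^sub>0))" for x
    using \<phi>_le[OF chain.start] by simp
  have fD: "\<phi> x = ereal (f x)" if "x \<in> D" for x
    using that \<phi>_le0[of x] by (cases "\<phi> x") (auto simp: D_def f_def)
  have "0 \<le> \<phi> x\<^sub>0"
    unfolding \<phi>_def using chain_nonneg[OF cm \<Gamma>] by (intro INF_greatest) auto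
  then have x0D: "x\<^sub>0 \<in> D" by (auto simp: D_def)
  have fx0: "0 \<le> f x\<^sub>0" using \<open>0 \<le> \<phi> x\<^sub>0\<close> fD[OF x0D] by simp
  \<comment> \<open>Any chain ending with a hop to \<open>x\<close> can be prolonged through
    \<open>(x, y)\<close> and then hop to \<open>x'\<close>. Only a real constant is added to
    \<open>\<phi> x'\<close>, which avoids differences of infinities.\<close>
  have \<phi>_step: "\<phi> x' + ereal (c (x, y) - c (x', y)) \<le> \<phi> x" if xy: "(x, y) \<in> \<Gamma>" for x y x'
    unfolding \<phi>_def[of x]
  proof (rule INF_greatest)
    fix p assume "p \<in> {(y, s). chain c \<Gamma> x\<^sub>0 y\<^sub>0 y s}"
    then have "\<phi> x' \<le> ereal (c (x', y) + (snd p + c (x, fst p) - c (x, y)))"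
      by (intro \<phi>_le chain.step xy) auto
    then have "\<phi> x' + ereal (c (x, y) - c (x', y)) \<le>
        ereal (c (x', y) + (snd p + c (x, fst p) - c (x, y))) + ereal (c (x, y) - c (x', y))"
      by (rule add_right_mono)
    then show "\<phi> x' + ereal (c (x, y) - c (x', y)) \<le> ereal (c (x, fst p) + snd p)"
      by (simp add: algebra_simps)
  qed
  \<comment> \<open>With the base point as \<open>x'\<close>, the previous inequality bounds
    \<open>\<phi> x\<close> from below by a real number.\<close>
  have \<Gamma>D: "x \<in> D" if "(x, y) \<in> \<Gamma>" for x y
    using \<phi>_step[OF that, of x\<^sub>0] fD[OF x0D] by (auto simp: D_def)
  have \<psi>_le: "\<psi> y \<le> ereal (c (x, y) - f x)" if "x \<in> D" for x y
    unfolding \<psi>_def using that by (intro INF_lower) auto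
  have gE: "\<psi> y = ereal (g y)" if "y \<in> E" for y
    using that \<psi>_le[OF x0D, of y] by (cases "\<psi> y") (auto simp: E_def g_def)
  \<comment> \<open>For a point of \<Gamma>, \<open>\<phi>_step\<close> says that the infimum
    defining \<open>\<psi> y\<close> is attained at its own \<open>x\<close>.\<close>
  have \<psi>\<Gamma>: "\<psi> y = ereal (c (x, y) - f x)" if xy: "(x, y) \<in> \<Gamma>" for x y
  proof (rule antisym)
    show "\<psi> y \<le> ereal (c (x, y) - f x)" using \<Gamma>D[OF xy] by (rule \<psi>_le)
    show "ereal (c (x, y) - f x) \<le> \<psi> y"
      unfolding \<psi>_def
    proof (rule INF_greatest)
      fix x' assume "x' \<in> D"
      then show "ereal (c (x, y) - f x) \<le> ereal (c (x', y) - f x')"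
        using \<phi>_step[OF xy, of x'] fD[of x'] fD[OF \<Gamma>D[OF xy]] by simp
    qed
  qed
  show thesis
  proof (rule that)
    show "f \<in> borel_measurable borel" "g \<in> borel_measurable borel"
      unfolding f_def g_def by measurable
    show "D \<in> sets borel" "E \<in> sets borel" unfolding D_def E_def by measurable
    show "\<Gamma> \<subseteq> D \<times> E" using \<Gamma>D \<psi>\<Gamma> by (auto simp: E_def)
    show "f x + g y = c (x, y)" if "(x, y) \<in> \<Gamma>" for x y
      using \<psi>\<Gamma>[OF that] by (simp add: g_def)
    show le: "f x + g y \<le> c (x, y)" if "x \<in> D" "y \<in> E" for x y
      using \<psi>_le[OF that(1), of y] gE[OF that(2)] by simp
    show "f x \<le> c (x, y\<^sub>0)" if "x \<in> D" for x
      using \<phi>_le0[of x] fD[OF that] nn[of "(x\<^sub>0, y\<^sub>0)"] by simp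
    show "g y \<le> c (x\<^sub>0, y)" if "y \<in> E" for y
      using le[OF x0D that] fx0 by simp
  qed
qed

text \<open>On the support \<open>f x + g y = c (x, y) \<ge> 0\<close>, so the upper bounds of the two potentials by
  integrable functions also bound them from below.\<close>

lemma cyclically_monotone_supp_optimal:
  fixes c :: "'a::polish_space \<times> 'b::polish_space \<Rightarrow> real"
  assumes c: "continuous_on UNIV c" and nn: "\<And>z. 0 \<le> c z"
    and cX[measurable]: "c\<^sub>X \<in> borel_measurable borel" and cY[measurable]: "c\<^sub>Y \<in> borel_measurable borel"
    and le: "\<And>x y. c (x, y) \<le> c\<^sub>X x + c\<^sub>Y y"
    and \<mu>: "finite_measure \<mu>"
    and g: "coupling \<mu> \<nu> \<gamma>" and i: "integrable \<mu> c\<^sub>X" "integrable \<nu> c\<^sub>Y"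
    and cm: "cyclically_monotone c (supp \<gamma>)"
  shows "optimal_coupling c \<mu> \<nu> \<gamma>"
  unfolding optimal_coupling_def
proof (intro conjI allI impI g)
  fix \<gamma>' assume g': "coupling \<mu> \<nu> \<gamma>'"
  have sg[measurable_cong]: "sets \<gamma> = sets borel" "sets \<gamma>' = sets borel"
    using coupling_sets(1)[OF g] coupling_sets(1)[OF g'] by auto
  have c_meas[measurable]: "c \<in> borel_measurable borel" using c by (rule borel_measurable_continuous_onI)
  have supp: "AE z in \<gamma>. z \<in> supp \<gamma>" using sg(1) by (rule AE_in_supp)
  show "plan_cost c \<gamma> \<le> plan_cost c \<gamma>'"
  proof (cases "supp \<gamma> = {}")
    \<comment> \<open>No base point exists, but then the plan vanishes and costs nothing.\<close>
    case True
    then have "plan_cost c \<gamma> = (\<integral>\<^sup>+z. 0 \<partial>\<gamma>)"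
      unfolding plan_cost_def using supp by (intro nn_integral_cong_AE) auto
    then show ?thesis by simp
  next
    case False
    then obtain x\<^sub>0 y\<^sub>0 where "(x\<^sub>0, y\<^sub>0) \<in> supp \<gamma>" by auto
    from cyclically_monotone_potentials[OF c nn cm this]
    obtain f h D E where [measurable]: "f \<in> borel_measurable borel" "h \<in> borel_measurable borel"
      and DE[measurable]: "D \<in> sets borel" "E \<in> sets borel" and sub: "supp \<gamma> \<subseteq> D \<times> E"
      and eq: "\<And>x y. (x, y) \<in> supp \<gamma> \<Longrightarrow> f x + h y = c (x, y)"
      and fh: "\<And>x y. x \<in> D \<Longrightarrow> y \<in> E \<Longrightarrow> f x + h y \<le> c (x, y)"
      and f_le: "\<And>x. x \<in> D \<Longrightarrow> f x \<le> c (x, y\<^sub>0)" and h_le: "\<And>y. y \<in> E \<Longrightarrow> h y \<le> c (x\<^sub>0, y)"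
      by metis
    interpret \<gamma>: finite_measure \<gamma> by (rule coupling_finite[OF g \<mu>])
    \<comment> \<open>The lower bound of \<open>f x\<close> comes from the upper bound of
      \<open>h y\<close> at the partner \<open>y\<close>, so both coordinates enter. Integrability
      is therefore shown on the plan first and then moved to the marginals.\<close>
    have bounds: "\<bar>f x\<bar> \<le> \<bar>c\<^sub>X x\<bar> + \<bar>c\<^sub>Y y\<bar> + (\<bar>c\<^sub>Y y\<^sub>0\<bar> + \<bar>c\<^sub>X x\<^sub>0\<bar>)"
      "\<bar>h y\<bar> \<le> \<bar>c\<^sub>X x\<bar> + \<bar>c\<^sub>Y y\<bar> + (\<bar>c\<^sub>Y y\<^sub>0\<bar> + \<bar>c\<^sub>X x\<^sub>0\<bar>)"
      if "(x, y) \<in> supp \<gamma>" for x y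
    proof -
      have "x \<in> D" "y \<in> E" using that sub by auto
      then show "\<bar>f x\<bar> \<le> \<bar>c\<^sub>X x\<bar> + \<bar>c\<^sub>Y y\<bar> + (\<bar>c\<^sub>Y y\<^sub>0\<bar> + \<bar>c\<^sub>X x\<^sub>0\<bar>)"
        "\<bar>h y\<bar> \<le> \<bar>c\<^sub>X x\<bar> + \<bar>c\<^sub>Y y\<bar> + (\<bar>c\<^sub>Y y\<^sub>0\<bar> + \<bar>c\<^sub>X x\<^sub>0\<bar>)"
        using f_le[of x] h_le[of y] eq[OF that] nn[of "(x, y)"] le[of x y\<^sub>0] le[of x\<^sub>0 y] by linarith+
    qed
    have dom: "integrable \<gamma> (\<lambda>z. \<bar>c\<^sub>X (fst z)\<bar> + \<bar>c\<^sub>Y (snd z)\<bar> + (\<bar>c\<^sub>Y y\<^sub>0\<bar> + \<bar>c\<^sub>X x\<^sub>0\<bar>))"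
      using i coupling_integrable_fst(1)[OF g cX] coupling_integrable_snd(1)[OF g cY] by auto
    have "integrable \<gamma> (\<lambda>z. f (fst z))" "integrable \<gamma> (\<lambda>z. h (snd z))"
      by (rule Bochner_Integration.integrable_bound[OF dom]; use supp bounds in \<open>auto elim!: eventually_mono\<close>)+
    then have int: "integrable \<mu> f" "integrable \<nu> h"
      using coupling_integrable_fst(1)[OF g, of f] coupling_integrable_snd(1)[OF g, of h] by auto
    have pot: "integrable \<eta> (\<lambda>z. f (fst z) + h (snd z))"
      "(LINT z|\<eta>. f (fst z) + h (snd z)) = (LINT x|\<mu>. f x) + (LINT y|\<nu>. h y)"
      if \<eta>: "coupling \<mu> \<nu> \<eta>" for \<eta>
      using int coupling_integrable_fst[OF \<eta>, of f] coupling_integrable_snd[OF \<eta>, of h] by auto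
    have ci: "integrable \<eta> c" if "coupling \<mu> \<nu> \<eta>" for \<eta>
      by (rule coupling_cost_integrable[OF c_meas nn cX cY le that i])
    \<comment> \<open>Full measure of \<open>D\<close> and \<open>E\<close> is a property of the
      marginals, which \<gamma>' shares; this carries the inequality between potentials and cost to
      the competitor.\<close>
    have "AE x in \<mu>. x \<in> D" "AE y in \<nu>. y \<in> E"
    proof -
      have \<mu>\<nu>: "\<mu> = distr \<gamma> borel fst" "\<nu> = distr \<gamma> borel snd" using g by (auto simp: coupling_def)
      show "AE x in \<mu>. x \<in> D" "AE y in \<nu>. y \<in> E" unfolding \<mu>\<nu> using supp sub
        by (subst AE_distr_iff; auto elim!: eventually_mono)+
    qed
    then have "AE z in \<gamma>'. fst z \<in> D" "AE z in \<gamma>'. snd z \<in> E"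
    proof -
      have \<mu>\<nu>: "distr \<gamma>' borel fst = \<mu>" "distr \<gamma>' borel snd = \<nu>" using g' by (auto simp: coupling_def)
      show "AE z in \<gamma>'. fst z \<in> D" if "AE x in \<mu>. x \<in> D"
        using that unfolding \<mu>\<nu>[symmetric] by (subst (asm) AE_distr_iff) auto
      show "AE z in \<gamma>'. snd z \<in> E" if "AE y in \<nu>. y \<in> E"
        using that unfolding \<mu>\<nu>[symmetric] by (subst (asm) AE_distr_iff) auto
    qed
    then have fh': "AE z in \<gamma>'. f (fst z) + h (snd z) \<le> c z"
    proof eventually_elim
      case (elim z)
      then show ?case using fh[of "fst z" "snd z"] by simp
    qed
    have "(LINT z|\<gamma>. c z) = (LINT z|\<gamma>. f (fst z) + h (snd z))"
      using supp eq by (intro integral_cong_AE) (auto elim!: eventually_mono)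
    also have "\<dots> = (LINT z|\<gamma>'. f (fst z) + h (snd z))" by (simp only: pot(2)[OF g] pot(2)[OF g'])
    also have "\<dots> \<le> (LINT z|\<gamma>'. c z)"
      by (intro integral_mono_AE pot(1)[OF g'] ci[OF g'] fh')
    finally show ?thesis
      using plan_cost_finite(1)[OF nn ci[OF g]] plan_cost_finite(1)[OF nn ci[OF g']]
      by (simp add: ennreal_leI)
  qed
qed

section \<open>Jordan decompositions and total variation\<close>

text \<open>On a Hahn set \<open>P\<close> the part \<open>n\<close> vanishes, so
  \<open>p A = b (A \<inter> P) \<le> p' (A \<inter> P) \<le> p' A\<close>. Applied to
  \<open>A\<close> and its complement, equality of the total masses leaves no room for
  strictness.\<close>

lemma jordan_decomposition_minimal:
  fixes b :: "'a::topological_space set \<Rightarrow> real"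
  assumes J: "jordan_decomposition b p n"
    and s: "sets p' = sets borel" "sets n' = sets borel"
    and fin: "finite_measure p'" "finite_measure n'"
    and b: "\<And>B. B \<in> sets borel \<Longrightarrow> b B = measure p' B - measure n' B"
    and mass: "measure p' UNIV = measure p UNIV"
  shows "p' = p" "n' = n"
proof -
  interpret p: finite_measure p using J by (simp add: jordan_decomposition_def)
  interpret n: finite_measure n using J by (simp add: jordan_decomposition_def)
  interpret p': finite_measure p' by fact
  interpret n': finite_measure n' by fact
  have sp[simp]: "sets p = sets borel" "sets n = sets borel"
    using J by (auto simp: jordan_decomposition_def)
  note s[simp]
  obtain P where P[measurable]: "P \<in> sets borel" and P0: "emeasure p (- P) = 0" "emeasure n P = 0"
    using J by (auto simp: jordan_decomposition_def mutually_singular_def)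
  have le: "measure p A \<le> measure p' A" if A: "A \<in> sets borel" for A
  proof -
    have "measure p A = measure p (A \<inter> P) + measure p (A - P)"
      using A by (subst p.finite_measure_Union[symmetric]) (auto intro!: arg_cong[of _ _ "measure p"])
    moreover have "measure p (A - P) \<le> measure p (- P)" "measure n (A \<inter> P) \<le> measure n P"
      "measure p' (A \<inter> P) \<le> measure p' A"
      using A by (auto intro!: p.finite_measure_mono n.finite_measure_mono p'.finite_measure_mono)
    moreover have "measure p (- P) = 0" "measure n P = 0" using P0 by (auto simp: measure_def)
    moreover have "measure p (A \<inter> P) - measure n (A \<inter> P) = measure p' (A \<inter> P) - measure n' (A \<inter> P)"
      using J A b[of "A \<inter> P"] by (auto simp: jordan_decomposition_def)
    ultimately show ?thesis
      using measure_nonneg[of n "A \<inter> P"] measure_nonneg[of n' "A \<inter> P"] by linarith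
  qed
  have eq: "measure p' A = measure p A" if A: "A \<in> sets borel" for A
  proof -
    have "measure p UNIV = measure p A + measure p (- A)"
      using A by (subst p.finite_measure_Union[symmetric]) auto
    moreover have "measure p' UNIV = measure p' A + measure p' (- A)"
      using A by (subst p'.finite_measure_Union[symmetric]) auto
    ultimately show ?thesis using le[OF A] le[of "- A"] A mass by auto
  qed
  have eq': "measure n' A = measure n A" if "A \<in> sets borel" for A
    using eq[OF that] b[OF that] J that by (auto simp: jordan_decomposition_def)
  show "p' = p" using eq by (intro measure_eqI) (auto simp: p.emeasure_eq_measure p'.emeasure_eq_measure)
  show "n' = n" using eq' by (intro measure_eqI) (auto simp: n.emeasure_eq_measure n'.emeasure_eq_measure)
qed

lemma signed_parts:
  assumes "finite_signed_measure a"
  shows "sets (positive_part a) = sets borel" "sets (negative_part a) = sets borel"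
    "finite_measure (positive_part a)" "finite_measure (negative_part a)"
  using jordan_decomposition_parts[OF assms] by (auto simp: jordan_decomposition_def)

lemma total_variation_sum:
  assumes a: "finite_signed_measure a" and A: "A \<in> sets borel"
  shows "emeasure (total_variation a) A =
    (\<Sum>t\<in>UNIV. emeasure (if t then positive_part a else negative_part a) A)"
  using emeasure_total_variation(2)[OF a A] by (simp add: UNIV_bool add.commute)

lemma sets_total_variation: "finite_signed_measure a \<Longrightarrow> sets (total_variation a) = sets borel"
  using emeasure_total_variation(1)[of a "{}"] by simp

lemma nn_integral_total_variation:
  assumes a: "finite_signed_measure a" and f: "f \<in> borel_measurable borel"
  shows "(\<integral>\<^sup>+x. f x \<partial>total_variation a) = (\<integral>\<^sup>+x. f x \<partial>positive_part a) + (\<integral>\<^sup>+x. f x \<partial>negative_part a)"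
proof -
  have "(\<integral>\<^sup>+x. f x \<partial>total_variation a) =
      (\<Sum>t\<in>UNIV. \<integral>\<^sup>+x. f x \<partial>(if t then positive_part a else negative_part a))"
    using f sets_total_variation[OF a] signed_parts[OF a] total_variation_sum[OF a]
    by (intro nn_integral_eq_sum) (auto cong: measurable_cong_sets)
  then show ?thesis by (simp add: UNIV_bool add.commute)
qed

lemma integrable_total_variation:
  fixes f :: "'a::topological_space \<Rightarrow> real"
  assumes a: "finite_signed_measure a" and f: "f \<in> borel_measurable borel"
    and i: "integrable (total_variation a) f"
  shows "integrable (positive_part a) f" "integrable (negative_part a) f"
proof -
  have "(\<integral>\<^sup>+x. ennreal (norm (f x)) \<partial>total_variation a) < \<infinity>"
    using i by (simp add: integrable_iff_bounded)
  then show "integrable (positive_part a) f" "integrable (negative_part a) f"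
    using f signed_parts[OF a]
    by (auto simp: integrable_iff_bounded nn_integral_total_variation[OF a] cong: measurable_cong_sets)
qed

lemma finite_total_variation:
  assumes a: "finite_signed_measure a"
  shows "finite_measure (total_variation a)"
proof
  note signed_parts(3,4)[OF a]
  then show "emeasure (total_variation a) (space (total_variation a)) \<noteq> \<infinity>"
    by (simp add: emeasure_total_variation[OF a] sets_eq_imp_space_eq[OF sets_total_variation[OF a]]
        finite_measure.emeasure_finite)
qed

lemma measure_total_variation:
  assumes a: "finite_signed_measure a" and A: "A \<in> sets borel"
  shows "measure (total_variation a) A = measure (positive_part a) A + measure (negative_part a) A"
  using signed_parts(3,4)[OF a]
  by (simp add: measure_def emeasure_total_variation(2)[OF a A] enn2real_plus less_top[symmetric]
      finite_measure.emeasure_finite)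

section \<open>Markov kernels, and real integrals of densities\<close>

text \<open>The formula for \<open>kernel_product\<close> is given on all Borel sets, not just
  rectangles, because supports are tested on arbitrary open sets.\<close>

lemma kernel_facts:
  fixes K :: "'a::second_countable_topology \<Rightarrow> 'b::second_countable_topology measure"
  assumes K: "K \<in> borel \<rightarrow>\<^sub>M prob_algebra borel"
  shows kernel_prob: "prob_space (K x)" and sets_kernel: "sets (K x) = sets borel"
    and emeasure_kernel_measurable: "B \<in> sets borel \<Longrightarrow> (\<lambda>x. emeasure (K x) B) \<in> borel_measurable borel"
    and emeasure_kernel_Pair_measurable:
      "S \<in> sets borel \<Longrightarrow> (\<lambda>x. emeasure (distr (K x) borel (Pair x)) S) \<in> borel_measurable borel"
    and sets_bind_kernel: "sets \<mu> = sets borel \<Longrightarrow> sets (\<mu> \<bind> K) = sets borel"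
    and emeasure_bind_kernel: "sets \<mu> = sets borel \<Longrightarrow> B \<in> sets borel \<Longrightarrow>
      emeasure (\<mu> \<bind> K) B = (\<integral>\<^sup>+x. emeasure (K x) B \<partial>\<mu>)"
    and emeasure_kernel_product_eq: "sets \<mu> = sets borel \<Longrightarrow> S \<in> sets borel \<Longrightarrow>
      emeasure (kernel_product \<mu> K) S = (\<integral>\<^sup>+x. emeasure (distr (K x) borel (Pair x)) S \<partial>\<mu>)"
proof -
  have K': "K \<in> borel \<rightarrow>\<^sub>M subprob_algebra borel" by (rule measurable_prob_algebraD[OF K])
  show "prob_space (K x)" and sK: "sets (K x) = sets borel" for x
    using measurable_space[OF K, of x] by (simp_all add: space_prob_algebra)
  have L: "(\<lambda>x. distr (K x) borel (Pair x)) \<in> borel \<rightarrow>\<^sub>M subprob_algebra borel"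
    by (rule measurable_distr2[OF _ K']) (simp add: borel_prod)
  show "(\<lambda>x. emeasure (K x) B) \<in> borel_measurable borel" if "B \<in> sets borel"
    using measurable_emeasure_kernel[OF K' that] .
  show "(\<lambda>x. emeasure (distr (K x) borel (Pair x)) S) \<in> borel_measurable borel" if "S \<in> sets borel"
    using measurable_emeasure_kernel[OF L that] .
  assume \<mu>: "sets \<mu> = sets borel"
  have sp: "space \<mu> = UNIV" using sets_eq_imp_space_eq[OF \<mu>] by simp
  show "sets (\<mu> \<bind> K) = sets borel" using sK sp by (intro sets_bind) auto
  have K\<mu>: "K \<in> \<mu> \<rightarrow>\<^sub>M subprob_algebra borel" "(\<lambda>x. distr (K x) borel (Pair x)) \<in> \<mu> \<rightarrow>\<^sub>M subprob_algebra borel"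
    using K' L by (simp_all add: measurable_cong_sets[OF \<mu> refl])
  show "emeasure (\<mu> \<bind> K) B = (\<integral>\<^sup>+x. emeasure (K x) B \<partial>\<mu>)" if "B \<in> sets borel"
    using K\<mu> that sp by (intro emeasure_bind) auto
  show "emeasure (kernel_product \<mu> K) S = (\<integral>\<^sup>+x. emeasure (distr (K x) borel (Pair x)) S \<partial>\<mu>)" if "S \<in> sets borel"
    unfolding kernel_product_def using K\<mu> that sp by (intro emeasure_bind) auto
qed

lemma emeasure_bind_kernel_UNIV:
  fixes K :: "'a::second_countable_topology \<Rightarrow> 'b::second_countable_topology measure"
  assumes K: "K \<in> borel \<rightarrow>\<^sub>M prob_algebra borel" and \<mu>: "sets \<mu> = sets borel"
  shows "emeasure (\<mu> \<bind> K) UNIV = emeasure \<mu> UNIV"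
proof -
  have "emeasure (K x) UNIV = 1" for x
    using prob_space.emeasure_space_1[OF kernel_prob[OF K]] by (simp add: sets_eq_imp_space_eq[OF sets_kernel[OF K]])
  then show ?thesis
    using emeasure_bind_kernel[OF K \<mu>, of UNIV] sets_eq_imp_space_eq[OF \<mu>] by simp
qed

lemma finite_bind_kernel:
  fixes K :: "'a::second_countable_topology \<Rightarrow> 'b::second_countable_topology measure"
  assumes K: "K \<in> borel \<rightarrow>\<^sub>M prob_algebra borel" and \<mu>: "sets \<mu> = sets borel" "finite_measure \<mu>"
  shows "finite_measure (\<mu> \<bind> K)"
proof
  show "emeasure (\<mu> \<bind> K) (space (\<mu> \<bind> K)) \<noteq> \<infinity>"
    using emeasure_bind_kernel_UNIV[OF K \<mu>(1)] finite_measure.emeasure_finite[OF \<mu>(2)]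
    by (simp add: sets_eq_imp_space_eq[OF sets_bind_kernel[OF K \<mu>(1)]])
qed

lemma measure_bind_kernel:
  fixes K :: "'a::second_countable_topology \<Rightarrow> 'b::second_countable_topology measure"
  assumes K: "K \<in> borel \<rightarrow>\<^sub>M prob_algebra borel" and \<mu>: "sets \<mu> = sets borel" and B: "B \<in> sets borel"
  shows "measure (\<mu> \<bind> K) B = (LINT x|\<mu>. measure (K x) B)"
proof -
  have [measurable]: "(\<lambda>x. measure (K x) B) \<in> borel_measurable \<mu>"
    using emeasure_kernel_measurable[OF K B] unfolding measure_def
    by (simp add: measurable_cong_sets[OF \<mu> refl])
  have "emeasure (K x) B = ennreal (measure (K x) B)" for x
    using kernel_prob[OF K, of x] by (simp add: prob_space_def finite_measure.emeasure_eq_measure)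
  then show ?thesis
    by (subst integral_eq_nn_integral) (auto simp: measure_def[of "\<mu> \<bind> K"] emeasure_bind_kernel[OF K \<mu> B])
qed

text \<open>Links the real-valued \<open>signed_density\<close> to measures: a finite integral makes
  \<open>h\<close> finite almost everywhere, so \<open>enn2real\<close> loses nothing.\<close>

lemma integral_enn2real_density:
  fixes h :: "'a \<Rightarrow> ennreal"
  assumes h[measurable]: "h \<in> borel_measurable M" and S[measurable]: "S \<in> sets M"
    and fin: "(\<integral>\<^sup>+x. h x \<partial>M) < \<infinity>"
  shows "integrable M (\<lambda>x. indicator S x * enn2real (h x))"
    and "(LINT x|M. indicator S x * enn2real (h x)) = measure (density M h) S"
proof -
  have "AE x in M. h x \<noteq> \<infinity>" using fin by (intro nn_integral_noteq_infinite) auto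
  then have eq: "(\<integral>\<^sup>+x. ennreal (indicator S x * enn2real (h x)) \<partial>M) = emeasure (density M h) S"
    unfolding emeasure_density[OF h S]
    by (intro nn_integral_cong_AE) (auto elim!: eventually_mono simp: indicator_def less_top)
  have "emeasure (density M h) S \<le> (\<integral>\<^sup>+x. h x \<partial>M)"
    unfolding emeasure_density[OF h S] by (intro nn_integral_mono) (auto simp: indicator_def)
  then have fin': "emeasure (density M h) S < \<infinity>" using fin by (rule order.strict_trans1)
  show "integrable M (\<lambda>x. indicator S x * enn2real (h x))"
    using eq fin' by (intro integrableI_nonneg) auto
  show "(LINT x|M. indicator S x * enn2real (h x)) = measure (density M h) S"
    using eq by (subst integral_eq_nn_integral) (auto simp: measure_def)
qed

section \<open>The two directions of the equivalence\<close>

text \<open>Bounded means dominated by a sum of functions of one variable; \<open>c\<close> itself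
  may be unbounded.\<close>

locale bounded_cost =
  fixes c :: "'a::polish_space \<times> 'b::polish_space \<Rightarrow> real"
    and c\<^sub>X :: "'a \<Rightarrow> real" and c\<^sub>Y :: "'b \<Rightarrow> real"
  assumes cont: "continuous_on UNIV c" and nonneg: "\<And>z. 0 \<le> c z"
    and cX[measurable]: "c\<^sub>X \<in> borel_measurable borel" and cY[measurable]: "c\<^sub>Y \<in> borel_measurable borel"
    and cost_le: "\<And>x y. c (x, y) \<le> c\<^sub>X x + c\<^sub>Y y"
begin

lemma cost_measurable[measurable]: "c \<in> borel_measurable borel"
  using cont by (rule borel_measurable_continuous_onI)

lemma coupling_plan_cost_finite:
  "coupling \<mu> \<nu> \<gamma> \<Longrightarrow> integrable \<mu> c\<^sub>X \<Longrightarrow> integrable \<nu> c\<^sub>Y \<Longrightarrow> plan_cost c \<gamma> < \<infinity>"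
  by (intro plan_cost_finite(2) nonneg coupling_cost_integrable[OF cost_measurable nonneg cX cY cost_le])

lemma optimal_supp_cyclically_monotone:
  "optimal_coupling c \<mu> \<nu> \<gamma> \<Longrightarrow> finite_measure \<mu> \<Longrightarrow> integrable \<mu> c\<^sub>X \<Longrightarrow> integrable \<nu> c\<^sub>Y \<Longrightarrow>
    cyclically_monotone c (supp \<gamma>)"
  by (rule optimal_coupling_supp_cyclically_monotone[OF cont nonneg])
     (auto simp: optimal_coupling_def dest: coupling_plan_cost_finite)

end

locale signed_marginals = bounded_cost +
  fixes a :: "'a::polish_space set \<Rightarrow> real" and b :: "'b::polish_space set \<Rightarrow> real"
  assumes a: "finite_signed_measure a" and b: "finite_signed_measure b"
    and tv_eq: "measure (total_variation a) UNIV = measure (total_variation b) UNIV"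
    and mass_eq: "a UNIV = b UNIV"
    and int_a: "integrable (total_variation a) c\<^sub>X" and int_b: "integrable (total_variation b) c\<^sub>Y"
begin

text \<open>The sums of the masses of the two parts agree by \<open>tv_eq\<close>, their differences
  by \<open>mass_eq\<close>.\<close>

lemma part_mass:
  "measure (positive_part a) UNIV = measure (positive_part b) UNIV"
  "measure (negative_part a) UNIV = measure (negative_part b) UNIV"
  using jordan_decomposition_parts[OF a] jordan_decomposition_parts[OF b] tv_eq mass_eq
    measure_total_variation[OF a, of UNIV] measure_total_variation[OF b, of UNIV]
  by (auto simp: jordan_decomposition_def)

lemma parts_unique:
  assumes "sets p' = sets borel" "sets n' = sets borel" "finite_measure p'" "finite_measure n'"
    and "\<And>B. B \<in> sets borel \<Longrightarrow> b B = measure p' B - measure n' B"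
    and "measure p' UNIV = measure (positive_part a) UNIV"
  shows "p' = positive_part b" "n' = negative_part b"
  using jordan_decomposition_minimal[OF jordan_decomposition_parts[OF b] assms(1-5)] assms(6) part_mass
  by auto

lemmas int_parts = integrable_total_variation[OF a cX int_a] integrable_total_variation[OF b cY int_b]

lemma markov_kernel_couplings:
  assumes opt: "optimal_transport_kernel c c\<^sub>X c\<^sub>Y (Markov K)"
    and im: "\<And>B. B \<in> sets borel \<Longrightarrow> kernel_image a (Markov K) B = b B"
  shows "\<exists>\<gamma>\<^sub>p \<gamma>\<^sub>n. optimal_coupling c (positive_part a) (positive_part b) \<gamma>\<^sub>p \<and>
       optimal_coupling c (negative_part a) (negative_part b) \<gamma>\<^sub>n \<and> cm_compatible c \<gamma>\<^sub>p \<gamma>\<^sub>n"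
proof -
  have K: "K \<in> borel \<rightarrow>\<^sub>M prob_algebra borel" using opt by simp
  have optK: "optimal_coupling c \<mu> (\<mu> \<bind> K) (kernel_product \<mu> K)"
    if "sets \<mu> = sets borel" "finite_measure \<mu>" "integrable \<mu> c\<^sub>X" "integrable (\<mu> \<bind> K) c\<^sub>Y" for \<mu>
  proof -
    have "transport_cost c \<mu> (\<mu> \<bind> K) < \<infinity>"
      using that emeasure_bind_kernel_UNIV[OF K that(1)] sets_bind_kernel[OF K that(1)] finite_bind_kernel[OF K that(1,2)]
      by (intro transport_cost_finite[OF cost_measurable nonneg cX cY cost_le]) auto
    then show ?thesis using opt that by simp
  qed
  note sa = signed_parts[OF a]
  have "b B = measure (positive_part a \<bind> K) B - measure (negative_part a \<bind> K) B" if "B \<in> sets borel" for B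
    using im[OF that] by (simp add: signed_integral_def measure_bind_kernel[OF K _ that] sa)
  \<comment> \<open>A Markov kernel preserves mass, which is the mass condition of
    \<open>parts_unique\<close>.\<close>
  moreover have "measure (positive_part a \<bind> K) UNIV = measure (positive_part a) UNIV"
    using emeasure_bind_kernel_UNIV[OF K sa(1)] by (simp add: measure_def)
  ultimately have parts: "positive_part a \<bind> K = positive_part b" "negative_part a \<bind> K = negative_part b"
    using sets_bind_kernel[OF K sa(1)] sets_bind_kernel[OF K sa(2)]
      finite_bind_kernel[OF K sa(1,3)] finite_bind_kernel[OF K sa(2,4)]
    by (intro parts_unique[of "positive_part a \<bind> K" "negative_part a \<bind> K"]; simp)+
  have tv: "total_variation a \<bind> K = total_variation b"
  proof (rule measure_eqI)
    show "sets (total_variation a \<bind> K) = sets (total_variation b)"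
      using sets_bind_kernel[OF K sets_total_variation[OF a]] sets_total_variation[OF b] by simp
    fix B assume "B \<in> sets (total_variation a \<bind> K)"
    then have B: "B \<in> sets borel" using sets_bind_kernel[OF K sets_total_variation[OF a]] by simp
    show "emeasure (total_variation a \<bind> K) B = emeasure (total_variation b) B"
      using emeasure_bind_kernel[OF K _ B] emeasure_kernel_measurable[OF K B] parts sa
      by (simp add: sets_total_variation[OF a] nn_integral_total_variation[OF a]
          emeasure_total_variation(2)[OF b B] flip: parts)
  qed
  let ?G = "\<lambda>\<mu>. kernel_product \<mu> K"
  have optp: "optimal_coupling c (positive_part a) (positive_part b) (?G (positive_part a))"
    and optn: "optimal_coupling c (negative_part a) (negative_part b) (?G (negative_part a))"
    and optt: "optimal_coupling c (total_variation a) (total_variation b) (?G (total_variation a))"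
    using optK[of "positive_part a"] optK[of "negative_part a"] optK[of "total_variation a"]
      sa int_parts int_a int_b parts tv sets_total_variation[OF a] finite_total_variation[OF a] by simp_all
  have cm: "cyclically_monotone c (supp (?G (total_variation a)))"
    by (rule optimal_supp_cyclically_monotone[OF optt finite_total_variation[OF a] int_a int_b])
  \<comment> \<open>The plan depends additively on its first marginal, so an open set charged by
    either part is charged by the plan of the total variation.\<close>
  have "emeasure (?G (total_variation a)) U = emeasure (?G (positive_part a)) U + emeasure (?G (negative_part a)) U"
    if "open U" for U
    using emeasure_kernel_product_eq[OF K _ borel_open[OF that]]
      emeasure_kernel_Pair_measurable[OF K borel_open[OF that]] sa sets_total_variation[OF a]
    by (simp add: nn_integral_total_variation[OF a])
  then have "supp (?G (positive_part a)) \<union> supp (?G (negative_part a)) \<subseteq> supp (?G (total_variation a))"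
    by (intro Un_least supp_mono) (auto simp: add_pos_nonneg add_nonneg_pos)
  then have "cm_compatible c (?G (positive_part a)) (?G (negative_part a))"
    using cm unfolding cm_compatible_def cyclically_monotone_def by (meson subset_iff)
  then show ?thesis using optp optn by blast
qed

lemma associated_kernel_couplings:
  assumes opt: "optimal_transport_kernel c c\<^sub>X c\<^sub>Y (Associated \<gamma>)"
    and dom: "in_kernel_domain c\<^sub>X (Associated \<gamma>) a"
    and im: "\<And>B. B \<in> sets borel \<Longrightarrow> kernel_image a (Associated \<gamma>) B = b B"
  shows "\<exists>\<gamma>\<^sub>p \<gamma>\<^sub>n. optimal_coupling c (positive_part a) (positive_part b) \<gamma>\<^sub>p \<and>
       optimal_coupling c (negative_part a) (negative_part b) \<gamma>\<^sub>n \<and> cm_compatible c \<gamma>\<^sub>p \<gamma>\<^sub>n"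
proof -
  obtain \<mu> \<nu> where fin\<mu>: "finite_measure \<mu>" "finite_measure \<nu>" and i: "integrable \<mu> c\<^sub>X" "integrable \<nu> c\<^sub>Y"
    and og: "optimal_coupling c \<mu> \<nu> \<gamma>" using opt by auto
  have g: "coupling \<mu> \<nu> \<gamma>" using og by (simp add: optimal_coupling_def)
  then have \<mu>: "distr \<gamma> borel fst = \<mu>" by (simp add: coupling_def)
  have s\<mu>[simp, measurable_cong]: "sets \<mu> = sets borel" and s\<gamma>[simp, measurable_cong]: "sets \<gamma> = sets borel"
    using coupling_sets[OF g] by auto
  interpret \<mu>: finite_measure \<mu> by fact
  interpret \<gamma>: finite_measure \<gamma> by (rule coupling_finite[OF g fin\<mu>(1)])
  note sa = signed_parts[OF a]
  note sa[simp]
  obtain M where ac: "absolutely_continuous \<mu> (total_variation a)"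
    and M: "AE x in \<mu>. \<bar>signed_density \<mu> a x\<bar> \<le> M"
    using dom unfolding in_kernel_domain.simps \<mu> by blast
  have acp: "absolutely_continuous \<mu> (positive_part a)" "absolutely_continuous \<mu> (negative_part a)"
  proof -
    have "A \<in> null_sets (positive_part a)" "A \<in> null_sets (negative_part a)" if "A \<in> null_sets \<mu>" for A
    proof -
      have A: "A \<in> sets borel" using null_setsD2[OF that] by simp
      have "emeasure (total_variation a) A = 0"
        using ac that by (auto simp: absolutely_continuous_def)
      then show "A \<in> null_sets (positive_part a)" "A \<in> null_sets (negative_part a)"
        using A by (auto intro!: null_setsI simp: emeasure_total_variation(2)[OF a A])
    qed
    then show "absolutely_continuous \<mu> (positive_part a)" "absolutely_continuous \<mu> (negative_part a)"
      unfolding absolutely_continuous_def by blast+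
  qed
  define F where "F = RN_deriv \<mu> (positive_part a)"
  define H where "H = RN_deriv \<mu> (negative_part a)"
  have FH[measurable]: "F \<in> borel_measurable borel" "H \<in> borel_measurable borel"
    using borel_measurable_RN_deriv[of \<mu>] by (simp_all add: F_def H_def cong: measurable_cong_sets)
  have dF: "density \<mu> F = positive_part a" "density \<mu> H = negative_part a"
    unfolding F_def H_def using acp by (auto intro!: \<mu>.density_RN_deriv)
  have emp: "emeasure (positive_part a) A = (\<integral>\<^sup>+x. F x * indicator A x \<partial>\<mu>)"
    "emeasure (negative_part a) A = (\<integral>\<^sup>+x. H x * indicator A x \<partial>\<mu>)" if "A \<in> sets borel" for A
    unfolding dF[symmetric] using that by (auto intro!: emeasure_density)
  obtain P where P[measurable]: "P \<in> sets borel"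
    and P0: "emeasure (positive_part a) (- P) = 0" "emeasure (negative_part a) P = 0"
    using jordan_decomposition_parts[OF a] by (auto simp: jordan_decomposition_def mutually_singular_def)
  \<comment> \<open>At almost every point one of \<open>F\<close>, \<open>H\<close> vanishes, so the
    bound on the absolute value of their difference bounds each of them.\<close>
  have "AE x in \<mu>. F x * indicator (- P) x = 0" "AE x in \<mu>. H x * indicator P x = 0"
    using P0 emp[of "- P"] emp[of P] by (auto simp: nn_integral_0_iff_AE)
  \<comment> \<open>The bound in the kernel domain concerns \<open>enn2real\<close> values, and
    \<open>enn2real\<close> sends infinity to 0; finiteness has to be secured separately.\<close>
  moreover have "AE x in \<mu>. F x \<noteq> \<infinity>" "AE x in \<mu>. H x \<noteq> \<infinity>"
    unfolding F_def H_def
    by (rule \<mu>.RN_deriv_finite; use acp in \<open>simp add: finite_measure.axioms(1) finite_measure.sigma_finite_measure\<close>)+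
  \<comment> \<open>The given \<open>M\<close> may fail to be positive, for instance if \<mu>
    vanishes, whereas \<open>optimal_coupling_density\<close> asks for a positive bound; hence
    \<open>max M 1\<close>.\<close>
  ultimately have bnd: "AE x in \<mu>. F x \<le> ennreal (max M 1) \<and> H x \<le> ennreal (max M 1)"
    using M
  proof eventually_elim
    case (elim x)
    have "enn2real (F x) \<le> M \<or> F x = 0" "enn2real (H x) \<le> M \<or> H x = 0"
      using elim by (auto simp: signed_density_def F_def[symmetric] H_def[symmetric] indicator_def split: if_splits)
    then have "enn2real (F x) \<le> max M 1" "enn2real (H x) \<le> max M 1" by auto
    then show ?case using elim by (auto intro!: enn2real_le simp del: max.bounded_iff)
  qed
  define f where "f z = F (fst z)" for z :: "'a \<times> 'b"
  define h where "h z = H (fst z)" for z :: "'a \<times> 'b"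
  have fh[measurable]: "f \<in> borel_measurable borel" "h \<in> borel_measurable borel"
    unfolding f_def h_def by measurable
  have "AE z in \<gamma>. F (fst z) \<le> ennreal (max M 1) \<and> H (fst z) \<le> ennreal (max M 1)"
    using bnd unfolding \<mu>[symmetric] by (subst (asm) AE_distr_iff) auto
  then have fb: "AE z in \<gamma>. f z \<le> ennreal (max M 1)" "AE z in \<gamma>. h z \<le> ennreal (max M 1)"
    by (auto simp: f_def h_def)
  \<comment> \<open>The densities depend on the first coordinate only, so the first marginals are
    \<open>density \<mu> F\<close> and \<open>density \<mu> H\<close>.\<close>
  have fst_em: "emeasure (density \<gamma> f) (fst -` A) = emeasure (positive_part a) A"
    "emeasure (density \<gamma> h) (fst -` A) = emeasure (negative_part a) A" if A[measurable]: "A \<in> sets borel" for A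
  proof -
    have ind: "indicator (fst -` A) z = (indicator A (fst z) :: ennreal)" for z :: "'a \<times> 'b"
      by (auto simp: indicator_def)
    have [measurable]: "(fst -` A :: ('a \<times> 'b) set) \<in> sets borel" using A by (rule vimage_fst_borel)
    show "emeasure (density \<gamma> f) (fst -` A) = emeasure (positive_part a) A"
      "emeasure (density \<gamma> h) (fst -` A) = emeasure (negative_part a) A"
      unfolding emp[OF A] \<mu>[symmetric]
      by (simp_all add: emeasure_density nn_integral_distr ind f_def h_def)
  qed
  define p where "p = distr (density \<gamma> f) borel snd"
  define n where "n = distr (density \<gamma> h) borel snd"
  have pfst: "distr (density \<gamma> f) borel fst = positive_part a" "distr (density \<gamma> h) borel fst = negative_part a"
    using fst_em by (auto intro!: measure_eqI simp: emeasure_distr_borel)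
  have cp: "coupling (positive_part a) p (density \<gamma> f)" "coupling (negative_part a) n (density \<gamma> h)"
    using coupling_distr[of "density \<gamma> f"] coupling_distr[of "density \<gamma> h"] by (simp_all add: pfst p_def n_def)
  have UNIV_eq: "emeasure p UNIV = emeasure (positive_part a) UNIV" "emeasure n UNIV = emeasure (negative_part a) UNIV"
    using coupling_fst[OF cp(1), of UNIV] coupling_snd[OF cp(1), of UNIV]
      coupling_fst[OF cp(2), of UNIV] coupling_snd[OF cp(2), of UNIV] by auto
  have fin_fh: "(\<integral>\<^sup>+z. f z \<partial>\<gamma>) < \<infinity>" "(\<integral>\<^sup>+z. h z \<partial>\<gamma>) < \<infinity>"
    using fst_em[of UNIV] sa(3,4)[THEN finite_measure.emeasure_finite, of UNIV]
    by (simp_all add: emeasure_density less_top[symmetric])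
  have fin_pn: "finite_measure p" "finite_measure n"
    using UNIV_eq sa(3,4)[THEN finite_measure.emeasure_finite, of UNIV]
    by (auto intro!: finite_measureI simp: p_def n_def)
  have "b B = measure p B - measure n B" if B[measurable]: "B \<in> sets borel" for B
  proof -
    have S: "snd -` B \<in> sets \<gamma>" using vimage_snd_borel[OF B] by simp
    have "measure p B = measure (density \<gamma> f) (snd -` B)" "measure n B = measure (density \<gamma> h) (snd -` B)"
      using coupling_snd[OF cp(1) B] coupling_snd[OF cp(2) B] by (auto simp: measure_def)
    moreover have "b B = (LINT z|\<gamma>. indicator (snd -` B) z * enn2real (f z) - indicator (snd -` B) z * enn2real (h z))"
      unfolding im[OF B, symmetric]
      by (simp add: associated_product_def set_lebesgue_integral_def signed_density_def \<mu> f_def h_def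
          F_def H_def right_diff_distrib)
    ultimately show ?thesis
      using integral_enn2real_density[of f \<gamma>, OF _ S fin_fh(1)] integral_enn2real_density[of h \<gamma>, OF _ S fin_fh(2)]
      by simp
  qed
  then have pn: "p = positive_part b" "n = negative_part b"
    using fin_pn UNIV_eq by (intro parts_unique[of p n]; simp add: p_def n_def measure_def)+
  have "optimal_coupling c (positive_part a) (positive_part b) (density \<gamma> f)"
    "optimal_coupling c (negative_part a) (negative_part b) (density \<gamma> h)"
    using optimal_coupling_density[OF og coupling_plan_cost_finite[OF g i] cost_measurable fh(1) _ fb(1)]
      optimal_coupling_density[OF og coupling_plan_cost_finite[OF g i] cost_measurable fh(2) _ fb(2)]
    by (simp_all add: pfst flip: pn p_def n_def)
  moreover have "cm_compatible c (density \<gamma> f) (density \<gamma> h)"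
  proof -
    have "emeasure (density \<gamma> k) U = 0" if [measurable]: "k \<in> borel_measurable borel" and "open U" "emeasure \<gamma> U = 0" for k U
    proof -
      have "U \<in> null_sets \<gamma>" using that by (auto simp: null_sets_def)
      then show ?thesis using absolutely_continuousI_density[of k \<gamma>]
        by (auto simp: absolutely_continuous_def null_sets_def)
    qed
    then have "supp (density \<gamma> f) \<union> supp (density \<gamma> h) \<subseteq> supp \<gamma>"
      using fh by (intro Un_least supp_mono) (metis not_gr_zero)+
    then show ?thesis
      using optimal_supp_cyclically_monotone[OF og fin\<mu>(1) i]
      unfolding cm_compatible_def cyclically_monotone_def by (meson subset_iff)
  qed
  ultimately show ?thesis by blast
qed

lemma compatible_couplings_connected:
  assumes op: "optimal_coupling c (positive_part a) (positive_part b) \<gamma>\<^sub>p"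
    and on: "optimal_coupling c (negative_part a) (negative_part b) \<gamma>\<^sub>n"
    and cm: "cm_compatible c \<gamma>\<^sub>p \<gamma>\<^sub>n"
  shows "connected_by_kernel c c\<^sub>X c\<^sub>Y a b"
proof -
  have gp: "coupling (positive_part a) (positive_part b) \<gamma>\<^sub>p" and gn: "coupling (negative_part a) (negative_part b) \<gamma>\<^sub>n"
    using op on by (auto simp: optimal_coupling_def)
  have [simp]: "sets \<gamma>\<^sub>p = sets borel" "sets \<gamma>\<^sub>n = sets borel"
    using coupling_sets[OF gp] coupling_sets[OF gn] by auto
  note sa = signed_parts[OF a]
  note sa[simp]
  define \<gamma> where "\<gamma> = sum_measure UNIV (\<lambda>t. if t then \<gamma>\<^sub>p else \<gamma>\<^sub>n)"
  have s\<gamma>[simp, measurable_cong]: "sets \<gamma> = sets borel" by (simp add: \<gamma>_def)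
  have em: "emeasure \<gamma> S = emeasure \<gamma>\<^sub>p S + emeasure \<gamma>\<^sub>n S" if "S \<in> sets borel" for S
    unfolding \<gamma>_def using that by (subst emeasure_sum_measure) (auto simp: UNIV_bool add.commute)
  have g: "coupling (total_variation a) (total_variation b) \<gamma>"
  proof (rule couplingI)
    show "emeasure \<gamma> (fst -` A) = emeasure (total_variation a) A" if "A \<in> sets borel" for A
      using em[OF vimage_fst_borel[OF that]] coupling_fst[OF gp that] coupling_fst[OF gn that]
      by (simp add: emeasure_total_variation(2)[OF a that])
    show "emeasure \<gamma> (snd -` B) = emeasure (total_variation b) B" if "B \<in> sets borel" for B
      using em[OF vimage_snd_borel[OF that]] coupling_snd[OF gp that] coupling_snd[OF gn that]
      by (simp add: emeasure_total_variation(2)[OF b that])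
  qed (use a b in \<open>auto simp: sets_total_variation\<close>)
  then have \<mu>: "distr \<gamma> borel fst = total_variation a" by (simp add: coupling_def)
  interpret tv: finite_measure "total_variation a" by (rule finite_total_variation[OF a])
  interpret \<gamma>: finite_measure \<gamma> by (rule coupling_finite[OF g]) unfold_locales
  note st[simp, measurable_cong] = sets_total_variation[OF a]
  \<comment> \<open>A point outside both supports has a null neighbourhood for each plan; their
    intersection is null for the sum.\<close>
  have "supp \<gamma> \<subseteq> supp \<gamma>\<^sub>p \<union> supp \<gamma>\<^sub>n"
  proof (rule subsetI, rule ccontr)
    fix z assume z: "z \<in> supp \<gamma>" "z \<notin> supp \<gamma>\<^sub>p \<union> supp \<gamma>\<^sub>n"
    then obtain U V where UV: "open U" "z \<in> U" "emeasure \<gamma>\<^sub>p U = 0" "open V" "z \<in> V" "emeasure \<gamma>\<^sub>n V = 0"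
      by (auto simp: supp_def not_gr_zero)
    have "emeasure \<gamma>\<^sub>p (U \<inter> V) \<le> emeasure \<gamma>\<^sub>p U" "emeasure \<gamma>\<^sub>n (U \<inter> V) \<le> emeasure \<gamma>\<^sub>n V"
      using UV by (intro emeasure_mono; simp)+
    then have "emeasure \<gamma> (U \<inter> V) = 0" using UV em[of "U \<inter> V"] by auto
    moreover have "emeasure \<gamma> (U \<inter> V) > 0" using z(1) UV by (auto simp: supp_def)
    ultimately show False by simp
  qed
  then have "cyclically_monotone c (supp \<gamma>)"
    using cm unfolding cm_compatible_def cyclically_monotone_def by (meson subset_iff)
  then have opt: "optimal_coupling c (total_variation a) (total_variation b) \<gamma>"
    using cyclically_monotone_supp_optimal[OF cont nonneg cX cY cost_le _ g int_a int_b] finite_total_variation[OF a]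
    by simp
  obtain P where P[measurable]: "P \<in> sets borel"
    and P0: "emeasure (positive_part a) (- P) = 0" "emeasure (negative_part a) P = 0"
    using jordan_decomposition_parts[OF a] by (auto simp: jordan_decomposition_def mutually_singular_def)
  \<comment> \<open>Generic in the space, as this and \<open>null\<close> are applied both to parts
    of \<open>a\<close> and to plans on the product.\<close>
  have split: "emeasure M A = emeasure M (A \<inter> Q) + emeasure M (A \<inter> - Q)"
    if "sets M = sets borel" "A \<in> sets borel" "Q \<in> sets borel" for M and A Q :: "'z::topological_space set"
    using that by (subst plus_emeasure) (auto intro!: arg_cong[of _ _ "emeasure M"])
  have null: "emeasure M (A \<inter> Q) = 0" "emeasure M (Q \<inter> A) = 0"
    if "sets M = sets borel" "A \<in> sets borel" "Q \<in> sets borel" "emeasure M Q = 0" for M and A Q :: "'z::topological_space set"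
    using emeasure_mono[of "A \<inter> Q" Q M] emeasure_mono[of "Q \<inter> A" Q M] that by auto
  \<comment> \<open>Restricting the total variation to a Hahn set or its complement returns a part
    of \<open>a\<close>; by uniqueness of derivatives, \<open>signed_density\<close> is then the
    sign of \<open>a\<close>.\<close>
  have restrict: "density (total_variation a) (indicator Q) = M"
    if [simp]: "sets M = sets borel" and Q: "Q \<in> sets borel"
      and eq: "\<And>A. A \<in> sets borel \<Longrightarrow> emeasure (total_variation a) (Q \<inter> A) = emeasure M A" for Q M
  proof (rule measure_eqI)
    fix A assume "A \<in> sets (density (total_variation a) (indicator Q))"
    then have A: "A \<in> sets borel" by simp
    have "emeasure (density (total_variation a) (indicator Q)) A = emeasure (total_variation a) (Q \<inter> A)"
      using A Q by (simp add: emeasure_density indicator_inter_arith[symmetric])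
    then show "emeasure (density (total_variation a) (indicator Q)) A = emeasure M A"
      using eq[OF A] by simp
  qed simp
  have "density (total_variation a) (indicator P) = positive_part a"
  proof (rule restrict)
    fix A :: "'a set" assume A: "A \<in> sets borel"
    then have PA: "P \<inter> A \<in> sets borel" "A \<inter> P = P \<inter> A" using P by auto
    show "emeasure (total_variation a) (P \<inter> A) = emeasure (positive_part a) A"
      using A P0 null(1)[of "positive_part a" A "- P"] null(2)[of "negative_part a" A P]
        split[of "positive_part a" A P] by (simp add: emeasure_total_variation(2)[OF a PA(1)] PA(2))
  qed simp_all
  moreover have "density (total_variation a) (indicator (- P)) = negative_part a"
  proof (rule restrict)
    fix A :: "'a set" assume A: "A \<in> sets borel"
    then have PA: "- P \<inter> A \<in> sets borel" "A \<inter> - P = - P \<inter> A" using P by auto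
    show "emeasure (total_variation a) (- P \<inter> A) = emeasure (negative_part a) A"
      using A P0 null(2)[of "positive_part a" A "- P"] null(1)[of "negative_part a" A P]
        split[of "negative_part a" A P] by (simp add: emeasure_total_variation(2)[OF a PA(1)] PA(2))
  qed simp_all
  ultimately have "AE x in total_variation a. indicator P x = RN_deriv (total_variation a) (positive_part a) x"
    "AE x in total_variation a. indicator (- P) x = RN_deriv (total_variation a) (negative_part a) x"
    by (auto intro!: tv.RN_deriv_unique)
  then have sd: "AE x in total_variation a. signed_density (total_variation a) a x = indicator P x - indicator (- P) x"
  proof eventually_elim
    case (elim x)
    then show ?case unfolding signed_density_def by (auto simp flip: elim simp: indicator_def)
  qed
  have [measurable]: "signed_density (total_variation a) a \<in> borel_measurable borel"
    using borel_measurable_RN_deriv[of "total_variation a"] unfolding signed_density_def[abs_def]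
    by (simp cong: measurable_cong_sets)
  have sd': "AE z in \<gamma>. signed_density (total_variation a) a (fst z) = indicator P (fst z) - indicator (- P) (fst z)"
  proof -
    have "AE x in distr \<gamma> borel fst. signed_density (total_variation a) a x = indicator P x - indicator (- P) x"
      unfolding \<mu> by (rule sd)
    then show ?thesis by (subst (asm) AE_distr_iff) auto
  qed
  have image: "kernel_image a (Associated \<gamma>) B = b B" if B: "B \<in> sets borel" for B
  proof -
    let ?S = "snd -` B :: ('a \<times> 'b) set" and ?P = "fst -` P :: ('a \<times> 'b) set"
    have [measurable]: "?S \<in> sets borel" "?P \<in> sets borel"
      using vimage_snd_borel[OF B] vimage_fst_borel[OF P] by auto
    have "kernel_image a (Associated \<gamma>) B =
        (LINT z|\<gamma>. indicator ?S z * signed_density (total_variation a) a (fst z))"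
      by (simp add: associated_product_def set_lebesgue_integral_def \<mu>)
    also have "\<dots> = (LINT z|\<gamma>. indicator (?S \<inter> ?P) z - indicator (?S \<inter> - ?P) z)"
    proof (rule integral_cong_AE)
      show "AE z in \<gamma>. indicator ?S z * signed_density (total_variation a) a (fst z) =
          indicator (?S \<inter> ?P) z - indicator (?S \<inter> - ?P) z"
        using sd' by eventually_elim (auto simp: indicator_def)
    qed measurable
    also have "\<dots> = measure \<gamma> (?S \<inter> ?P) - measure \<gamma> (?S \<inter> - ?P)"
      by (subst Bochner_Integration.integral_diff) (auto simp: less_top[symmetric])
    also have "emeasure \<gamma> (?S \<inter> ?P) = emeasure (positive_part b) B"
    proof -
      have "emeasure \<gamma>\<^sub>n ?P = 0" "emeasure \<gamma>\<^sub>p (- ?P) = 0"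
        using coupling_fst[OF gn P] coupling_fst[OF gp, of "- P"] P0 by (auto simp: vimage_Compl)
      then show ?thesis
        using em[of "?S \<inter> ?P"] split[of \<gamma>\<^sub>p ?S ?P] null[of \<gamma>\<^sub>p ?S "- ?P"] null[of \<gamma>\<^sub>n ?S ?P]
          coupling_snd[OF gp B] by simp
    qed
    then have "measure \<gamma> (?S \<inter> ?P) = measure (positive_part b) B" by (simp add: measure_def)
    also have "emeasure \<gamma> (?S \<inter> - ?P) = emeasure (negative_part b) B"
    proof -
      have "emeasure \<gamma>\<^sub>n ?P = 0" "emeasure \<gamma>\<^sub>p (- ?P) = 0"
        using coupling_fst[OF gn P] coupling_fst[OF gp, of "- P"] P0 by (auto simp: vimage_Compl)
      then show ?thesis
        using em[of "?S \<inter> - ?P"] split[of \<gamma>\<^sub>n ?S ?P] null[of \<gamma>\<^sub>p ?S "- ?P"] null[of \<gamma>\<^sub>n ?S ?P]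
          coupling_snd[OF gn B] by simp
    qed
    then have "measure \<gamma> (?S \<inter> - ?P) = measure (negative_part b) B" by (simp add: measure_def)
    also have "measure (positive_part b) B - measure (negative_part b) B = b B"
      using jordan_decomposition_parts[OF b] B by (simp add: jordan_decomposition_def)
    finally show ?thesis .
  qed
  have "optimal_transport_kernel c c\<^sub>X c\<^sub>Y (Associated \<gamma>)"
    using opt int_a int_b finite_total_variation[OF a] finite_total_variation[OF b] by auto
  moreover have "in_kernel_domain c\<^sub>X (Associated \<gamma>) a"
  proof -
    \<comment> \<open>The density takes the values 1 and -1. Absolute continuity is immediate, the
      first marginal of \<gamma> being the total variation itself.\<close>
    have "AE x in total_variation a. \<bar>signed_density (total_variation a) a x\<bar> \<le> 1"
      using sd by eventually_elim (auto simp: indicator_def)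
    then show ?thesis
      using a int_a unfolding in_kernel_domain.simps \<mu> absolutely_continuous_def by blast
  qed
  ultimately show ?thesis unfolding connected_by_kernel_def using image by blast
qed

lemma connected_iff_compatible_couplings:
  "connected_by_kernel c c\<^sub>X c\<^sub>Y a b \<longleftrightarrow>
    (\<exists>\<gamma>\<^sub>p \<gamma>\<^sub>n. optimal_coupling c (positive_part a) (positive_part b) \<gamma>\<^sub>p \<and>
       optimal_coupling c (negative_part a) (negative_part b) \<gamma>\<^sub>n \<and>
       cm_compatible c \<gamma>\<^sub>p \<gamma>\<^sub>n)"
proof
  assume "connected_by_kernel c c\<^sub>X c\<^sub>Y a b"
  then obtain K where K: "optimal_transport_kernel c c\<^sub>X c\<^sub>Y K" "in_kernel_domain c\<^sub>X K a"
    "\<And>B. B \<in> sets borel \<Longrightarrow> kernel_image a K B = b B"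
    unfolding connected_by_kernel_def by blast
  show "\<exists>\<gamma>\<^sub>p \<gamma>\<^sub>n. optimal_coupling c (positive_part a) (positive_part b) \<gamma>\<^sub>p \<and>
       optimal_coupling c (negative_part a) (negative_part b) \<gamma>\<^sub>n \<and> cm_compatible c \<gamma>\<^sub>p \<gamma>\<^sub>n"
  proof (cases K)
    case (Markov k)
    show ?thesis using K(1,3) unfolding Markov by (rule markov_kernel_couplings)
  next
    case (Associated \<gamma>)
    show ?thesis using K unfolding Associated by (rule associated_kernel_couplings)
  qed
next
  assume "\<exists>\<gamma>\<^sub>p \<gamma>\<^sub>n. optimal_coupling c (positive_part a) (positive_part b) \<gamma>\<^sub>p \<and>
       optimal_coupling c (negative_part a) (negative_part b) \<gamma>\<^sub>n \<and> cm_compatible c \<gamma>\<^sub>p \<gamma>\<^sub>n"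
  then show "connected_by_kernel c c\<^sub>X c\<^sub>Y a b" using compatible_couplings_connected by blast
qed

end

theorem theorem5p1:
  fixes c :: "'a::polish_space \<times> 'b::polish_space \<Rightarrow> real"
    and c\<^sub>X :: "'a \<Rightarrow> real" and c\<^sub>Y :: "'b \<Rightarrow> real"
    and a :: "'a set \<Rightarrow> real" and b :: "'b set \<Rightarrow> real"
  assumes "continuous_on UNIV c" and "\<And>z. 0 \<le> c z"
    and "c\<^sub>X \<in> borel_measurable borel" and "c\<^sub>Y \<in> borel_measurable borel"
    and "\<And>x y. c (x, y) \<le> c\<^sub>X x + c\<^sub>Y y"
    and "finite_signed_measure a" and "finite_signed_measure b"
    and "measure (total_variation a) UNIV = measure (total_variation b) UNIV"
    and "a UNIV = b UNIV"
    and "integrable (total_variation a) c\<^sub>X" and "integrable (total_variation b) c\<^sub>Y"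
  shows "connected_by_kernel c c\<^sub>X c\<^sub>Y a b \<longleftrightarrow>
    (\<exists>\<gamma>\<^sub>p \<gamma>\<^sub>n. optimal_coupling c (positive_part a) (positive_part b) \<gamma>\<^sub>p \<and>
       optimal_coupling c (negative_part a) (negative_part b) \<gamma>\<^sub>n \<and>
       cm_compatible c \<gamma>\<^sub>p \<gamma>\<^sub>n)"
proof -
  interpret signed_marginals c c\<^sub>X c\<^sub>Y a b
    by unfold_locales (fact assms)+
  show ?thesis by (rule connected_iff_compatible_couplings)
qed

end
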